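(* There is a universal constant $c>0$ such that for any $M,K,R\ge1$, $H,\Delta>0$, $\sigma\ge0$, either Minibatch SGD or Single-Machine SGD (in the homogeneous intermittent communication setting, with suitable parameters) guarantees that for any objective $F\in\mathcal{F}_{-H}(H,\Delta)$ $$\mathbb{E}\|\nabla F(\hat x)\|\le c\cdot\min\left\{\frac{\sqrt{H\Delta}}{\sqrt{KR}}+\frac{\sqrt\sigma(H\Delta)^{1/4}}{(KR)^{1/4}},\ \frac{\sqrt{H\Delta}}{\sqrt R}+\frac{\sqrt\sigma(H\Delta)^{1/4}}{(MKR)^{1/4}},\ \sqrt{H\Delta}\right\}.$$
   Context: $\mathcal{F}_{-H}(H,\Delta)$: all $H$-smooth (gradient $H$-Lipschitz), possibly non-convex functions $F:\mathbb{R}^d\to\mathbb{R}$, $d\in\mathbb N$, with $F(0)-\min_xF(x)\le\Delta$. Homogeneous intermittent communication setting: $M$ machines, $R$ rounds of communication, $K$ oracle queries per machine per round. Each query at $x$ returns an independent stochastic gradient $g(x;z)$ with mean $\nabla F(x)$ and variance $\mathbb{E}\|g(x;z)-\nabla F(x)\|^2\le\sigma^2$. Minibatch SGD: start at $x_0=0$; in each round $r=0,\dots,R-1$ every machine computes $K$ stochastic gradients at $x_r$, all $MK$ of them are averaged into $\bar g_r=\frac1{MK}\sum_{m=1}^M\sum_{k=0}^{K-1}g(x_r;z^m_{k,r})$, and $x_{r+1}=x_r-\eta_r\bar g_r$. It returns $\hat x=\frac{1}{\sum_{r=1}^Rw_r}\sum_{r=1}^Rw_rx_r$. Single-Machine SGD: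 run SGD on one machine, ignoring the other $M-1$: start at $x_{0,0}=0$; for $r=0,\dots,R-1$ and $k=0,\dots,K-1$, $x_{k+1,r}=x_{k,r}-\eta_{k,r}g(x_{k,r};z_{k,r})$, and $x_{0,r+1}=x_{K,r}$ (so $KR$ steps in total). It returns the weighted average $\hat x=\frac{1}{\sum_{k,r}w_{k,r}}\sum_{k,r}w_{k,r}x_{k,r}$ of its iterates ($1\le k\le K$, $0\le r\le R-1$). The stepsizes $\eta$ and averaging weights $w$ are parameters of the methods and may depend on $H,\Delta,\sigma,M,K,R$.
   Formalization: The averaging weights may be random, drawn independently of the samples from a law fixed in advance, with the expectation also over them (e.g. a random iterate is returned); with fixed nonnegative weights the claim fails already for noiseless gradient descent. Samples z are real-valued. *)

theory Defs
  imports "HOL-Probability.Probability"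
begin

(* The dimension d is quantified underneath the universal constant and underneath the choice of
   the stepsizes and weights, so it cannot be a type.  R^d is the set of real sequences that vanish
   from index d on; the functions below are only constrained on this set. *)

definition Rd :: "nat \<Rightarrow> (nat \<Rightarrow> real) set" where
  "Rd d = {x. \<forall>i\<ge>d. x i = 0}"

abbreviation enorm :: "nat \<Rightarrow> (nat \<Rightarrow> real) \<Rightarrow> real" where
  "enorm d x \<equiv> L2_set x {..<d}"

(* The product topology on sequences induces the Euclidean topology on R^d. *)

definition borel_Rd :: "nat \<Rightarrow> (nat \<Rightarrow> real) measure" where
  "borel_Rd d = restrict_space borel (Rd d)"

(* Frechet differentiability on R^d, the derivative being the inner product with v. *)

definition has_gradient ::
    "nat \<Rightarrow> ((nat \<Rightarrow> real) \<Rightarrow> real) \<Rightarrow> (nat \<Rightarrow> real) \<Rightarrow> (nat \<Rightarrow> real) \<Rightarrow> bool" where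
  "has_gradient d F v x \<longleftrightarrow> v \<in> Rd d \<and>
     (\<forall>e>0. \<exists>\<delta>>0. \<forall>y\<in>Rd d. enorm d (\<lambda>i. y i - x i) < \<delta> \<longrightarrow>
        \<bar>F y - F x - (\<Sum>i<d. v i * (y i - x i))\<bar> \<le> e * enorm d (\<lambda>i. y i - x i))"

definition grad :: "nat \<Rightarrow> ((nat \<Rightarrow> real) \<Rightarrow> real) \<Rightarrow> (nat \<Rightarrow> real) \<Rightarrow> nat \<Rightarrow> real" where
  "grad d F x = (THE v. has_gradient d F v x)"

definition smooth :: "nat \<Rightarrow> real \<Rightarrow> ((nat \<Rightarrow> real) \<Rightarrow> real) \<Rightarrow> bool" where
  "smooth d H F \<longleftrightarrow> (\<forall>x\<in>Rd d. \<exists>v. has_gradient d F v x) \<and>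
     (\<forall>x\<in>Rd d. \<forall>y\<in>Rd d.
        enorm d (\<lambda>i. grad d F x i - grad d F y i) \<le> H * enorm d (\<lambda>i. x i - y i))"

definition nonconvex_class :: "nat \<Rightarrow> real \<Rightarrow> real \<Rightarrow> ((nat \<Rightarrow> real) \<Rightarrow> real) set" where
  "nonconvex_class d H \<Delta> = {F. smooth d H F \<and>
     (\<exists>xmin\<in>Rd d. (\<forall>x\<in>Rd d. F xmin \<le> F x) \<and> F (\<lambda>_. 0) - F xmin \<le> \<Delta>)}"

(* A query at x returns g x z for a fresh sample z of law D.  Joint measurability of g is what
   makes the gradients at the random iterates random variables.  The sample type is fixed to the
   reals so that the universal constant cannot depend on it; D may have any sigma-algebra.  This
   loses no generality: every sample is used in a single query, so the law of the iterates depends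
   on the oracle only through the Markov kernel that maps x to the law of g x z, and every Markov
   kernel on R^d is induced by a jointly measurable g and the uniform law on the unit interval.
   The variance bound is a nonnegative integral, hence includes finiteness. *)

definition stochastic_gradient ::
    "nat \<Rightarrow> ((nat \<Rightarrow> real) \<Rightarrow> real) \<Rightarrow> real \<Rightarrow> real measure
      \<Rightarrow> ((nat \<Rightarrow> real) \<Rightarrow> real \<Rightarrow> nat \<Rightarrow> real) \<Rightarrow> bool" where
  "stochastic_gradient d F \<sigma> D g \<longleftrightarrow> prob_space D \<and>
     (\<lambda>(x, z). g x z) \<in> borel_Rd d \<Otimes>\<^sub>M D \<rightarrow>\<^sub>M borel_Rd d \<and>
     (\<forall>x\<in>Rd d.
        (\<forall>i<d. integrable D (\<lambda>z. g x z i) \<and> (\<integral>z. g x z i \<partial>D) = grad d F x i) \<and>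
        (\<integral>\<^sup>+z. ennreal ((enorm d (\<lambda>i. g x z i - grad d F x i))\<^sup>2) \<partial>D) \<le> ennreal (\<sigma>\<^sup>2))"

(* The samples are indexed by (machine, query within the round, round). *)

definition samples :: "real measure \<Rightarrow> (nat \<times> nat \<times> nat \<Rightarrow> real) measure" where
  "samples D = Pi\<^sub>M UNIV (\<lambda>_. D)"

primrec minibatch_iter ::
    "((nat \<Rightarrow> real) \<Rightarrow> real \<Rightarrow> nat \<Rightarrow> real) \<Rightarrow> nat \<Rightarrow> nat \<Rightarrow> (nat \<Rightarrow> real)
      \<Rightarrow> (nat \<times> nat \<times> nat \<Rightarrow> real) \<Rightarrow> nat \<Rightarrow> nat \<Rightarrow> real" where
  "minibatch_iter g M K \<eta> z 0 = (\<lambda>_. 0)"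
| "minibatch_iter g M K \<eta> z (Suc r) =
     (let x = minibatch_iter g M K \<eta> z r
      in (\<lambda>i. x i - \<eta> r * (1 / (real M * real K) * (\<Sum>m<M. \<Sum>k<K. g x (z (m, k, r)) i))))"

definition minibatch_output ::
    "((nat \<Rightarrow> real) \<Rightarrow> real \<Rightarrow> nat \<Rightarrow> real) \<Rightarrow> nat \<Rightarrow> nat \<Rightarrow> nat \<Rightarrow> (nat \<Rightarrow> real) \<Rightarrow> (nat \<Rightarrow> real)
      \<Rightarrow> (nat \<times> nat \<times> nat \<Rightarrow> real) \<Rightarrow> nat \<Rightarrow> real" where
  "minibatch_output g M K R \<eta> w z =
     (\<lambda>i. 1 / (\<Sum>r=1..R. w r) * (\<Sum>r=1..R. w r * minibatch_iter g M K \<eta> z r i))"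

(* local_iter g \<eta> z r x k is the k-th iterate of round r when that round starts at x; the machine
   that is used has index 0.  Stepsizes and weights take the arguments k and r in this order. *)

primrec local_iter ::
    "((nat \<Rightarrow> real) \<Rightarrow> real \<Rightarrow> nat \<Rightarrow> real) \<Rightarrow> (nat \<Rightarrow> nat \<Rightarrow> real)
      \<Rightarrow> (nat \<times> nat \<times> nat \<Rightarrow> real) \<Rightarrow> nat \<Rightarrow> (nat \<Rightarrow> real) \<Rightarrow> nat \<Rightarrow> nat \<Rightarrow> real" where
  "local_iter g \<eta> z r x 0 = x"
| "local_iter g \<eta> z r x (Suc k) =
     (let y = local_iter g \<eta> z r x k in (\<lambda>i. y i - \<eta> k r * g y (z (0, k, r)) i))"

primrec round_start ::
    "((nat \<Rightarrow> real) \<Rightarrow> real \<Rightarrow> nat \<Rightarrow> real) \<Rightarrow> nat \<Rightarrow> (nat \<Rightarrow> nat \<Rightarrow> real)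
      \<Rightarrow> (nat \<times> nat \<times> nat \<Rightarrow> real) \<Rightarrow> nat \<Rightarrow> nat \<Rightarrow> real" where
  "round_start g K \<eta> z 0 = (\<lambda>_. 0)"
| "round_start g K \<eta> z (Suc r) = local_iter g \<eta> z r (round_start g K \<eta> z r) K"

definition single_iter ::
    "((nat \<Rightarrow> real) \<Rightarrow> real \<Rightarrow> nat \<Rightarrow> real) \<Rightarrow> nat \<Rightarrow> (nat \<Rightarrow> nat \<Rightarrow> real)
      \<Rightarrow> (nat \<times> nat \<times> nat \<Rightarrow> real) \<Rightarrow> nat \<Rightarrow> nat \<Rightarrow> nat \<Rightarrow> real" where
  "single_iter g K \<eta> z k r = local_iter g \<eta> z r (round_start g K \<eta> z r) k"

definition single_output ::
    "((nat \<Rightarrow> real) \<Rightarrow> real \<Rightarrow> nat \<Rightarrow> real) \<Rightarrow> nat \<Rightarrow> nat \<Rightarrow> (nat \<Rightarrow> nat \<Rightarrow> real)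
      \<Rightarrow> (nat \<Rightarrow> nat \<Rightarrow> real) \<Rightarrow> (nat \<times> nat \<times> nat \<Rightarrow> real) \<Rightarrow> nat \<Rightarrow> real" where
  "single_output g K R \<eta> w z =
     (\<lambda>i. 1 / (\<Sum>k=1..K. \<Sum>r<R. w k r) * (\<Sum>k=1..K. \<Sum>r<R. w k r * single_iter g K \<eta> z k r i))"

(* The weights are drawn from a distribution W that is fixed in advance, independently of the
   samples; fixed weights w are the case W = return_pmf w, and weights concentrated on one random
   index return a random iterate.  Some randomness is indispensable: for nonnegative stepsizes and
   weights that are fixed in advance, already gradient descent in dimension one (M = K = 1,
   sigma = 0) has objectives in the class with a gradient of order sqrt (H * Delta) at the output,
   for every R. *)

definition minibatch_params :: "nat \<Rightarrow> (nat \<Rightarrow> real) \<Rightarrow> (nat \<Rightarrow> real) pmf \<Rightarrow> bool" where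
  "minibatch_params R \<eta> W \<longleftrightarrow> (\<forall>r<R. \<eta> r > 0) \<and>
     (\<forall>w\<in>set_pmf W. (\<forall>r\<in>{1..R}. w r \<ge> 0) \<and> (\<Sum>r=1..R. w r) > 0)"

definition single_params ::
    "nat \<Rightarrow> nat \<Rightarrow> (nat \<Rightarrow> nat \<Rightarrow> real) \<Rightarrow> (nat \<Rightarrow> nat \<Rightarrow> real) pmf \<Rightarrow> bool" where
  "single_params K R \<eta> W \<longleftrightarrow> (\<forall>k<K. \<forall>r<R. \<eta> k r > 0) \<and>
     (\<forall>w\<in>set_pmf W. (\<forall>k\<in>{1..K}. \<forall>r<R. w k r \<ge> 0) \<and> (\<Sum>k=1..K. \<Sum>r<R. w k r) > 0)"

(* Nonnegative integrals: a bound on them includes integrability. *)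

definition minibatch_error ::
    "nat \<Rightarrow> ((nat \<Rightarrow> real) \<Rightarrow> real) \<Rightarrow> real measure \<Rightarrow> ((nat \<Rightarrow> real) \<Rightarrow> real \<Rightarrow> nat \<Rightarrow> real)
      \<Rightarrow> nat \<Rightarrow> nat \<Rightarrow> nat \<Rightarrow> (nat \<Rightarrow> real) \<Rightarrow> (nat \<Rightarrow> real) pmf \<Rightarrow> ennreal" where
  "minibatch_error d F D g M K R \<eta> W =
     (\<integral>\<^sup>+w. (\<integral>\<^sup>+z. ennreal (enorm d (grad d F (minibatch_output g M K R \<eta> w z))) \<partial>samples D)
        \<partial>measure_pmf W)"

definition single_error ::
    "nat \<Rightarrow> ((nat \<Rightarrow> real) \<Rightarrow> real) \<Rightarrow> real measure \<Rightarrow> ((nat \<Rightarrow> real) \<Rightarrow> real \<Rightarrow> nat \<Rightarrow> real)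
      \<Rightarrow> nat \<Rightarrow> nat \<Rightarrow> (nat \<Rightarrow> nat \<Rightarrow> real) \<Rightarrow> (nat \<Rightarrow> nat \<Rightarrow> real) pmf \<Rightarrow> ennreal" where
  "single_error d F D g K R \<eta> W =
     (\<integral>\<^sup>+w. (\<integral>\<^sup>+z. ennreal (enorm d (grad d F (single_output g K R \<eta> w z))) \<partial>samples D)
        \<partial>measure_pmf W)"

definition rate :: "nat \<Rightarrow> nat \<Rightarrow> nat \<Rightarrow> real \<Rightarrow> real \<Rightarrow> real \<Rightarrow> real" where
  "rate M K R H \<Delta> \<sigma> = Min
     {sqrt (H * \<Delta>) / sqrt (real K * real R)
        + sqrt \<sigma> * root 4 (H * \<Delta>) / root 4 (real K * real R),
      sqrt (H * \<Delta>) / sqrt (real R)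
        + sqrt \<sigma> * root 4 (H * \<Delta>) / root 4 (real M * real K * real R),
      sqrt (H * \<Delta>)}"

end

theory Submission
  imports Defs
begin

text \<open>
  Both methods are stochastic gradient descent whose step \<open>t\<close> averages a batch \<open>B t\<close> of \<open>b\<close> fresh
  samples: \<open>T = R\<close> steps with \<open>b = M K\<close> for Minibatch SGD, \<open>T = K R\<close> steps with \<open>b = 1\<close> for
  Single-Machine SGD. Fresh samples make the noise orthogonal to the past, so with \<open>s\<^sup>2 = \<sigma>\<^sup>2 / b\<close>
  the descent inequality for \<open>H\<close>-smooth functions telescopes to
  \<open>\<Sum>t<T. E |\<nabla>F(x\<^sub>t)|\<^sup>2 \<le> 2 \<Delta> / \<eta> + T H \<eta> s\<^sup>2\<close>. The methods only return iterates from \<open>x\<^sub>1\<close> on, but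
  one step at most doubles the gradient, up to noise of size \<open>\<eta> H s\<close>, which shifts the sum to
  \<open>t = 1, \<dots>, T\<close> at the cost of a constant. The stepsize \<open>\<eta> = 1 / (H + s sqrt (H T / \<Delta>))\<close> balances
  the terms, and a uniformly random iterate attains the first two expressions in the minimum. For
  the third, the first iterate after one step of length \<open>1 / (H + \<sigma> sqrt (H / \<Delta>))\<close> suffices, since
  \<open>|\<nabla>F(0)|\<^sup>2 \<le> 2 H \<Delta>\<close>.
\<close>

section \<open>Smooth functions on Euclidean space\<close>

lemma L2_set_cmult: "L2_set (\<lambda>i. c * f i) A = \<bar>c\<bar> * L2_set f A" for c :: real
  unfolding L2_set_def
  by (simp add: power_mult_distrib sum_distrib_left[symmetric] real_sqrt_mult)

lemma L2_set_squared: "(L2_set f A)\<^sup>2 = (\<Sum>i\<in>A. (f i)\<^sup>2)"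
  unfolding L2_set_def by (simp add: sum_nonneg)

lemma sum_mult_le_L2_set: "(\<Sum>i\<in>A. f i * g i) \<le> L2_set f A * L2_set g A"
proof -
  have "(\<Sum>i\<in>A. f i * g i) \<le> (\<Sum>i\<in>A. \<bar>f i\<bar> * \<bar>g i\<bar>)"
    by (intro sum_mono) (simp flip: abs_mult)
  then show ?thesis
    using L2_set_mult_ineq[of f g A] by linarith
qed

section \<open>Uniqueness of gradients\<close>

lemma Rd_zero [simp]: "(\<lambda>_. 0) \<in> Rd d"
  by (simp add: Rd_def)

lemma Rd_lincomb: "x \<in> Rd d \<Longrightarrow> y \<in> Rd d \<Longrightarrow> (\<lambda>i. x i + c * y i) \<in> Rd d"
  by (simp add: Rd_def)

lemma has_gradientE:
  assumes "has_gradient d F v x" "e > 0"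
  obtains \<delta> where "\<delta> > 0" "\<And>y. y \<in> Rd d \<Longrightarrow> enorm d (\<lambda>i. y i - x i) < \<delta> \<Longrightarrow>
    \<bar>F y - F x - (\<Sum>i<d. v i * (y i - x i))\<bar> \<le> e * enorm d (\<lambda>i. y i - x i)"
  using assms unfolding has_gradient_def by blast

text \<open>Both linear approximations are tested at \<open>x + t * (v - w)\<close> for one small
  \<open>t\<close>, where they differ by \<open>t\<close> times the squared norm of
  \<open>v - w\<close>. This makes the definite description in \<open>grad\<close>
  meaningful.\<close>

lemma has_gradient_unique:
  assumes v: "has_gradient d F v x" and w: "has_gradient d F w x" and x: "x \<in> Rd d"
  shows "v = w"
proof -
  define u where "u = (\<lambda>i. v i - w i)"
  define n where "n = enorm d u"
  have vw: "v \<in> Rd d" "w \<in> Rd d" using v w by (auto simp: has_gradient_def)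
  have n0: "n \<ge> 0" by (simp add: n_def)
  have n2: "n\<^sup>2 = (\<Sum>i<d. v i * u i) - (\<Sum>i<d. w i * u i)"
    unfolding n_def L2_set_squared
    by (simp add: u_def power2_eq_square algebra_simps flip: sum_subtractf)
  have "n = 0"
  proof (rule ccontr)
    assume "n \<noteq> 0"
    then have n: "n > 0" using n0 by simp
    \<comment> \<open>The two errors, each at most a third of \<open>t * n^2\<close>, cannot add up
      to a difference of \<open>t * n^2\<close>.\<close>
    then have n3: "n / 3 > 0" by simp
    obtain \<delta>1 where d1: "\<delta>1 > 0" "\<And>y. y \<in> Rd d \<Longrightarrow> enorm d (\<lambda>i. y i - x i) < \<delta>1 \<Longrightarrow>
        \<bar>F y - F x - (\<Sum>i<d. v i * (y i - x i))\<bar> \<le> n/3 * enorm d (\<lambda>i. y i - x i)"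
      using has_gradientE[OF v n3] by blast
    obtain \<delta>2 where d2: "\<delta>2 > 0" "\<And>y. y \<in> Rd d \<Longrightarrow> enorm d (\<lambda>i. y i - x i) < \<delta>2 \<Longrightarrow>
        \<bar>F y - F x - (\<Sum>i<d. w i * (y i - x i))\<bar> \<le> n/3 * enorm d (\<lambda>i. y i - x i)"
      using has_gradientE[OF w n3] by blast
    define t where "t = min \<delta>1 \<delta>2 / (2 * n)"
    have t: "t > 0" using d1 d2 n by (simp add: t_def)
    define y where "y = (\<lambda>i. x i + t * u i)"
    have y: "y \<in> Rd d" using x vw by (auto simp: y_def u_def Rd_def)
    have e: "enorm d (\<lambda>i. y i - x i) = t * n"
      using t by (simp add: y_def L2_set_cmult n_def)
    have "t * n < \<delta>1" "t * n < \<delta>2" using d1 d2 n by (auto simp: t_def)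
    then have "\<bar>F y - F x - (\<Sum>i<d. v i * (y i - x i))\<bar> \<le> n/3 * (t * n)"
      "\<bar>F y - F x - (\<Sum>i<d. w i * (y i - x i))\<bar> \<le> n/3 * (t * n)"
      using d1(2)[OF y] d2(2)[OF y] e by auto
    then have "(\<Sum>i<d. v i * (y i - x i)) - (\<Sum>i<d. w i * (y i - x i)) \<le> 2 * (n/3 * (t * n))"
      by linarith
    also have "(\<Sum>i<d. v i * (y i - x i)) - (\<Sum>i<d. w i * (y i - x i)) = t * n\<^sup>2"
      by (simp add: n2 y_def right_diff_distrib sum_distrib_left algebra_simps)
    finally have "t * n\<^sup>2 \<le> 2/3 * (t * n\<^sup>2)" by (simp add: power2_eq_square)
    moreover have "t * n\<^sup>2 > 0" using t n by simp
    ultimately show False by linarith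
  qed
  then have "\<forall>i<d. u i = 0" by (simp add: n_def L2_set_eq_0_iff)
  then show ?thesis using vw
    by (intro ext) (metis (mono_tags, lifting) Rd_def eq_iff_diff_eq_0 mem_Collect_eq not_le u_def)
qed

lemma has_gradient_grad:
  assumes "smooth d H F" "x \<in> Rd d"
  shows "has_gradient d F (grad d F x) x"
proof -
  obtain v where "has_gradient d F v x" using assms by (auto simp: smooth_def)
  then show ?thesis
    unfolding grad_def using has_gradient_unique[OF _ _ assms(2)] by (metis theI)
qed

lemma grad_in_Rd: "smooth d H F \<Longrightarrow> x \<in> Rd d \<Longrightarrow> grad d F x \<in> Rd d"
  using has_gradient_grad by (auto simp: has_gradient_def)

section \<open>The quadratic upper bound for smooth functions\<close>

lemma DERIV_along_line:
  assumes F: "smooth d H F" and x: "x \<in> Rd d" and u: "u \<in> Rd d"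
  shows "((\<lambda>t. F (\<lambda>i. x i + t * u i)) has_real_derivative
    (\<Sum>i<d. grad d F (\<lambda>i. x i + t * u i) i * u i)) (at t)"
  unfolding has_field_derivative_def has_derivative_at_alt
proof (intro conjI allI impI)
  define p where "p = (\<lambda>t i. x i + t * u i)"
  define n where "n = enorm d u"
  have p: "p t \<in> Rd d" for t using Rd_lincomb[OF x u] by (simp add: p_def)
  have n0: "n \<ge> 0" by (simp add: n_def)
  show "bounded_linear ((*) (\<Sum>i<d. grad d F (\<lambda>i. x i + t * u i) i * u i))"
    by (rule bounded_linear_mult_right)
  fix e :: real assume e: "e > 0"
  \<comment> \<open>Dividing by \<open>n + 1\<close> instead of \<open>n\<close> covers the
    direction \<open>u = 0\<close>; the price is only the factor
    \<open>n / (n + 1) <= 1\<close>.\<close>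
  then have en0: "e / (n + 1) > 0" using n0 by simp
  obtain \<delta> where \<delta>: "\<delta> > 0" "\<And>y. y \<in> Rd d \<Longrightarrow> enorm d (\<lambda>i. y i - p t i) < \<delta> \<Longrightarrow>
      \<bar>F y - F (p t) - (\<Sum>i<d. grad d F (p t) i * (y i - p t i))\<bar>
        \<le> e / (n + 1) * enorm d (\<lambda>i. y i - p t i)"
    using has_gradientE[OF has_gradient_grad[OF F p[of t]] en0] by blast
  show "\<exists>\<delta>>0. \<forall>s. norm (s - t) < \<delta> \<longrightarrow>
      norm (F (\<lambda>i. x i + s * u i) - F (\<lambda>i. x i + t * u i)
        - (\<Sum>i<d. grad d F (\<lambda>i. x i + t * u i) i * u i) * (s - t)) \<le> e * norm (s - t)"
  proof (intro exI[of _ "\<delta> / (n + 1)"] conjI allI impI)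
    show "\<delta> / (n + 1) > 0" using \<delta> n0 by simp
    fix s assume "norm (s - t) < \<delta> / (n + 1)"
    then have s: "\<bar>s - t\<bar> * (n + 1) < \<delta>" using n0 by (simp add: field_simps)
    have d: "p s i - p t i = (s - t) * u i" for i by (simp add: p_def algebra_simps)
    have en: "enorm d (\<lambda>i. p s i - p t i) = \<bar>s - t\<bar> * n"
      by (simp add: d L2_set_cmult n_def)
    have "\<bar>s - t\<bar> * n \<le> \<bar>s - t\<bar> * (n + 1)" by (simp add: mult_left_mono)
    then have "enorm d (\<lambda>i. p s i - p t i) < \<delta>" using s en by linarith
    from \<delta>(2)[OF p this]
    have "\<bar>F (p s) - F (p t) - (\<Sum>i<d. grad d F (p t) i * ((s - t) * u i))\<bar>
        \<le> e / (n + 1) * (\<bar>s - t\<bar> * n)"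
      by (simp only: d L2_set_cmult n_def)
    also have "\<dots> = e * \<bar>s - t\<bar> * (n / (n + 1))" by simp
    also have "\<dots> \<le> e * \<bar>s - t\<bar> * 1"
      using n0 e by (intro mult_left_mono) auto
    finally show "norm (F (\<lambda>i. x i + s * u i) - F (\<lambda>i. x i + t * u i)
        - (\<Sum>i<d. grad d F (\<lambda>i. x i + t * u i) i * u i) * (s - t)) \<le> e * norm (s - t)"
      by (simp add: p_def sum_distrib_left mult_ac)
  qed
qed

text \<open>The difference \<open>\<psi>\<close> of \<open>F\<close> and its quadratic upper bound
  along the segment has nonpositive derivative on \<open>[0, 1]\<close>, by Cauchy-Schwarz and the
  Lipschitz gradient. Monotonicity of \<open>\<psi>\<close> replaces integration of the
  gradient.\<close>

lemma smooth_descent: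
  assumes F: "smooth d H F" and x: "x \<in> Rd d" and u: "u \<in> Rd d"
  shows "F (\<lambda>i. x i + u i) \<le> F x + (\<Sum>i<d. grad d F x i * u i) + H / 2 * (enorm d u)\<^sup>2"
proof -
  define p where "p = (\<lambda>t i. x i + t * u i)"
  define A where "A = (\<Sum>i<d. grad d F x i * u i)"
  define \<psi> where "\<psi> t = F (p t) - t * A - H / 2 * (enorm d u)\<^sup>2 * t\<^sup>2" for t
  have p: "p t \<in> Rd d" for t using Rd_lincomb[OF x u] by (simp add: p_def)
  have "\<psi> 1 \<le> \<psi> 0"
  proof (rule DERIV_nonpos_imp_nonincreasing[where f = \<psi>])
    fix t :: real assume t: "0 \<le> t" "t \<le> 1"
    have D: "(\<psi> has_real_derivative
        (\<Sum>i<d. grad d F (p t) i * u i) - A - H * (enorm d u)\<^sup>2 * t) (at t)"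
      unfolding \<psi>_def p_def
      by (rule derivative_eq_intros DERIV_along_line[OF F x u] refl)+ simp
    have "(\<Sum>i<d. grad d F (p t) i * u i) - A = (\<Sum>i<d. (grad d F (p t) i - grad d F x i) * u i)"
      by (simp add: A_def left_diff_distrib sum_subtractf)
    also have "\<dots> \<le> enorm d (\<lambda>i. grad d F (p t) i - grad d F x i) * enorm d u"
      by (rule sum_mult_le_L2_set)
    also have "\<dots> \<le> (H * enorm d (\<lambda>i. p t i - x i)) * enorm d u"
      using F p[of t] x by (intro mult_right_mono) (auto simp: smooth_def)
    also have "enorm d (\<lambda>i. p t i - x i) = t * enorm d u"
      using t by (simp add: p_def L2_set_cmult)
    finally have "(\<Sum>i<d. grad d F (p t) i * u i) - A - H * (enorm d u)\<^sup>2 * t \<le> 0"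
      by (simp add: power2_eq_square mult_ac)
    with D show "\<exists>y. (\<psi> has_real_derivative y) (at t) \<and> y \<le> 0" by blast
  qed simp
  then show ?thesis by (simp add: \<psi>_def p_def A_def)
qed

lemma nonconvex_class_smooth: "F \<in> nonconvex_class d H \<Delta> \<Longrightarrow> smooth d H F"
  by (simp add: nonconvex_class_def)

lemma nonconvex_class_gap:
  "F \<in> nonconvex_class d H \<Delta> \<Longrightarrow> x \<in> Rd d \<Longrightarrow> F (\<lambda>_. 0) - F x \<le> \<Delta>"
  by (force simp: nonconvex_class_def)

text \<open>A gradient step of length \<open>1 / H\<close> from the origin lowers \<open>F\<close>
  by at least the squared gradient norm over \<open>2 * H\<close>, and no point lies more than
  \<open>\<Delta>\<close> below the origin.\<close>

lemma grad_zero_bound: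
  assumes F: "F \<in> nonconvex_class d H \<Delta>" and H: "H > 0"
  shows "(enorm d (grad d F (\<lambda>_. 0)))\<^sup>2 \<le> 2 * H * \<Delta>"
proof -
  define v where "v = grad d F (\<lambda>_. 0)"
  define u where "u = (\<lambda>i. - (1 / H) * v i)"
  note s = nonconvex_class_smooth[OF F]
  have u: "u \<in> Rd d"
    using grad_in_Rd[OF s Rd_zero] by (simp add: u_def v_def Rd_def)
  have "F (\<lambda>i. 0 + u i) \<le> F (\<lambda>_. 0) + (\<Sum>i<d. v i * u i) + H / 2 * (enorm d u)\<^sup>2"
    unfolding v_def by (rule smooth_descent[OF s Rd_zero u])
  moreover have "(\<Sum>i<d. v i * u i) = - (1 / H) * (enorm d v)\<^sup>2"
    unfolding L2_set_squared u_def sum_distrib_left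
    by (intro sum.cong) (auto simp: power2_eq_square)
  moreover have "(enorm d u)\<^sup>2 = (enorm d v)\<^sup>2 / H\<^sup>2"
    unfolding u_def L2_set_cmult by (simp add: power_mult_distrib power_divide)
  moreover have "F (\<lambda>_. 0) - F u \<le> \<Delta>" by (rule nonconvex_class_gap[OF F u])
  ultimately have "(enorm d v)\<^sup>2 / H - H / 2 * ((enorm d v)\<^sup>2 / H\<^sup>2) \<le> \<Delta>" by simp
  then show ?thesis using H by (simp add: v_def field_simps power2_eq_square)
qed

section \<open>Continuity and measurability of the gradient\<close>

lemma continuous_on_L2_set:
  fixes f :: "'a::topological_space \<Rightarrow> 'b \<Rightarrow> real"
  assumes "\<And>i. i \<in> A \<Longrightarrow> continuous_on S (\<lambda>x. f x i)"
  shows "continuous_on S (\<lambda>x. L2_set (f x) A)"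
  unfolding L2_set_def by (intro continuous_intros assms)

text \<open>Measurability refers to the product topology, the Lipschitz bound to
  \<open>enorm\<close>. Since \<open>enorm\<close> is continuous for the product topology, the bound
  squeezes each coordinate below \<open>d\<close>; the others vanish.\<close>

lemma continuous_on_grad:
  assumes F: "smooth d H F"
  shows "continuous_on (Rd d) (\<lambda>x. grad d F x i)"
proof (cases "i < d")
  case False
  then have "grad d F x i = 0" if "x \<in> Rd d" for x
    using grad_in_Rd[OF F that] by (simp add: Rd_def)
  then show ?thesis by (subst continuous_on_cong[OF refl, of _ _ "\<lambda>_. 0"]) auto
next
  case True
  show ?thesis unfolding continuous_on_def
  proof
    fix x assume x: "x \<in> Rd d"
    have "continuous_on (Rd d) (\<lambda>y. H * enorm d (\<lambda>i. y i - x i))"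
      by (intro continuous_intros continuous_on_L2_set continuous_on_subset[OF continuous_on_product_coordinates]) auto
    then have "((\<lambda>y. H * enorm d (\<lambda>i. y i - x i)) \<longlongrightarrow> H * enorm d (\<lambda>i. x i - x i)) (at x within Rd d)"
      using x by (auto simp: continuous_on_def)
    then have l: "((\<lambda>y. H * enorm d (\<lambda>i. y i - x i)) \<longlongrightarrow> 0) (at x within Rd d)"
      by (simp add: L2_set_0')
    have b: "\<bar>grad d F y i - grad d F x i\<bar> \<le> H * enorm d (\<lambda>i. y i - x i)" if "y \<in> Rd d" for y
    proof -
      have "\<bar>grad d F y i - grad d F x i\<bar> \<le> L2_set (\<lambda>i. \<bar>grad d F y i - grad d F x i\<bar>) {..<d}"
        using True by (intro member_le_L2_set) auto
      also have "\<dots> = enorm d (\<lambda>i. grad d F y i - grad d F x i)" by (simp add: L2_set_def)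
      also have "\<dots> \<le> H * enorm d (\<lambda>i. y i - x i)" using F that x by (auto simp: smooth_def)
      finally show ?thesis .
    qed
    have "((\<lambda>y. grad d F y i - grad d F x i) \<longlongrightarrow> 0) (at x within Rd d)"
      by (rule Lim_null_comparison[OF _ l]) (use b in \<open>auto simp: eventually_at_filter\<close>)
    then show "((\<lambda>y. grad d F y i) \<longlongrightarrow> grad d F x i) (at x within Rd d)"
      by (simp add: LIM_zero_iff)
  qed
qed

lemma measurable_borel_Rd_iff:
  "f \<in> measurable M (borel_Rd d) \<longleftrightarrow>
    (\<forall>i. (\<lambda>z. f z i) \<in> borel_measurable M) \<and> (\<forall>z\<in>space M. f z \<in> Rd d)"
proof -
  have "f \<in> borel_measurable M \<longleftrightarrow> (\<forall>i. (\<lambda>z. f z i) \<in> borel_measurable M)"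
    by (auto intro: measurable_coordinatewise_then_product
        measurable_compose[OF _ measurable_product_coordinates])
  then show ?thesis by (auto simp: borel_Rd_def measurable_restrict_space2_iff)
qed

lemma measurable_grad:
  assumes F: "smooth d H F" and X: "X \<in> measurable M (borel_Rd d)"
  shows "(\<lambda>z. grad d F (X z) i) \<in> borel_measurable M"
proof -
  have "(\<lambda>x. grad d F x i) \<in> borel_measurable (borel_Rd d)"
    unfolding borel_Rd_def
    by (rule borel_measurable_continuous_on_restrict[OF continuous_on_grad[OF F]])
  from measurable_compose[OF X this] show ?thesis .
qed

section \<open>Fresh samples and gradient noise\<close>

definition square_integrable :: "'a measure \<Rightarrow> ('a \<Rightarrow> real) \<Rightarrow> bool" where
  "square_integrable M f \<longleftrightarrow> f \<in> borel_measurable M \<and> integrable M (\<lambda>x. (f x)\<^sup>2)"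

lemma square_integrable_bound:
  assumes f: "f \<in> borel_measurable M" and h: "integrable M h"
    and b: "\<And>x. x \<in> space M \<Longrightarrow> (f x)\<^sup>2 \<le> h x"
  shows "square_integrable M f"
  unfolding square_integrable_def
proof
  show "integrable M (\<lambda>x. (f x)\<^sup>2)"
  proof (rule Bochner_Integration.integrable_bound[OF h])
    show "AE x in M. norm ((f x)\<^sup>2) \<le> norm (h x)"
      using b by (intro AE_I2) (simp add: order_trans[OF _ abs_ge_self])
  qed (use f in measurable)
qed (rule f)

lemma square_integrable_mult:
  assumes f: "square_integrable M f" and g: "square_integrable M g"
  shows "integrable M (\<lambda>x. f x * g x)"
proof (rule Bochner_Integration.integrable_bound)
  show "integrable M (\<lambda>x. (f x)\<^sup>2 + (g x)\<^sup>2)"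
    using f g by (auto simp: square_integrable_def)
  show "(\<lambda>x. f x * g x) \<in> borel_measurable M"
    using f g by (auto simp: square_integrable_def)
  have "\<bar>a * b\<bar> \<le> a\<^sup>2 + b\<^sup>2" for a b :: real
  proof -
    have "2 * (\<bar>a\<bar> * \<bar>b\<bar>) \<le> a\<^sup>2 + b\<^sup>2"
      using sum_squares_bound[of "\<bar>a\<bar>" "\<bar>b\<bar>"] by simp
    moreover have "\<bar>a\<bar> * \<bar>b\<bar> \<ge> 0" by simp
    ultimately show ?thesis unfolding abs_mult by linarith
  qed
  then show "AE x in M. norm (f x * g x) \<le> norm ((f x)\<^sup>2 + (g x)\<^sup>2)"
    by (intro AE_I2) (simp add: order_trans[OF _ abs_ge_self])
qed

lemma square_integrable_cmult:
  "square_integrable M f \<Longrightarrow> square_integrable M (\<lambda>x. c * f x)"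
  by (auto simp: square_integrable_def power_mult_distrib)

lemma square_integrable_add:
  assumes f: "square_integrable M f" and g: "square_integrable M g"
  shows "square_integrable M (\<lambda>x. f x + g x)"
  using square_integrable_mult[OF f g] f g
  by (auto simp: square_integrable_def power2_sum mult.assoc)

lemma square_integrable_zero: "square_integrable M (\<lambda>_. 0)"
  by (simp add: square_integrable_def)

lemma square_integrable_sum:
  "(\<And>i. i \<in> A \<Longrightarrow> square_integrable M (f i)) \<Longrightarrow> square_integrable M (\<lambda>x. \<Sum>i\<in>A. f i x)"
  by (induction A rule: infinite_finite_induct)
    (auto intro: square_integrable_add square_integrable_zero)

lemma square_integrable_L2_set:
  assumes "\<And>j. j \<in> A \<Longrightarrow> square_integrable M (\<lambda>x. f x j)"
  shows "square_integrable M (\<lambda>x. L2_set (f x) A)"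
    and "(\<integral>x. (L2_set (f x) A)\<^sup>2 \<partial>M) = (\<Sum>j\<in>A. \<integral>x. (f x j)\<^sup>2 \<partial>M)"
proof -
  have m: "(\<lambda>x. f x j) \<in> borel_measurable M" "integrable M (\<lambda>x. (f x j)\<^sup>2)" if "j \<in> A" for j
    using assms[OF that] by (auto simp: square_integrable_def)
  have "(\<lambda>x. sqrt (\<Sum>j\<in>A. (f x j)\<^sup>2)) \<in> borel_measurable M"
    by (intro measurable_compose[OF _ borel_measurable_sqrt] borel_measurable_sum borel_measurable_power m)
  then show "square_integrable M (\<lambda>x. L2_set (f x) A)"
    using m unfolding square_integrable_def L2_set_squared by (simp add: L2_set_def)
  show "(\<integral>x. (L2_set (f x) A)\<^sup>2 \<partial>M) = (\<Sum>j\<in>A. \<integral>x. (f x j)\<^sup>2 \<partial>M)"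
    using m unfolding L2_set_squared by simp
qed

section \<open>Resampling one coordinate of the product measure\<close>

context
  fixes D :: "real measure"
  assumes D: "prob_space D"
begin

interpretation D: prob_space D by (rule D)

lemma prob_space_samples: "prob_space (samples D)"
  unfolding samples_def by (intro prob_space_PiM D)

interpretation S: prob_space "samples D" by (rule prob_space_samples)

interpretation DS: pair_prob_space D "samples D" ..

lemma measurable_samples_update:
  "(\<lambda>(x, z). z(i := x)) \<in> measurable (D \<Otimes>\<^sub>M samples D) (samples D)"
  unfolding samples_def
proof (rule measurable_PiM_single')
  show "(\<lambda>p. (case p of (x, z) \<Rightarrow> z(i := x)) k)
      \<in> measurable (D \<Otimes>\<^sub>M Pi\<^sub>M UNIV (\<lambda>_. D)) D" for k
    by (cases "k = i") (auto simp: case_prod_unfold)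
qed (auto simp: space_pair_measure space_PiM PiE_def Pi_def)

lemma distr_samples_update:
  "distr (D \<Otimes>\<^sub>M samples D) (samples D) (\<lambda>(x, z). z(i := x)) = samples D"
  \<comment> \<open>For \<open>I = UNIV\<close> the enlarged index set \<open>insert i I\<close> is
    \<open>I\<close> itself, so extending the product by one factor amounts to overwriting a
    coordinate.\<close>
  using distr_pair_PiM_eq_PiM[where I = UNIV and M = "\<lambda>_. D" and i' = i] D
  by (simp add: samples_def)

text \<open>
  Resampling one coordinate preserves the law of the samples; this is how the independence of a
  fresh sample from the current iterate is expressed below.
\<close>
lemma nn_integral_samples_update:
  assumes f: "f \<in> borel_measurable (samples D)"
  shows "(\<integral>\<^sup>+z. f z \<partial>samples D) = (\<integral>\<^sup>+z. (\<integral>\<^sup>+x. f (z(i := x)) \<partial>D) \<partial>samples D)"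
proof -
  note m = measurable_samples_update[of i]
  have "(\<integral>\<^sup>+z. f z \<partial>samples D) = (\<integral>\<^sup>+z. f z \<partial>distr (D \<Otimes>\<^sub>M samples D) (samples D) (\<lambda>(x, z). z(i := x)))"
    by (simp add: distr_samples_update)
  also have "\<dots> = (\<integral>\<^sup>+p. f (case p of (x, z) \<Rightarrow> z(i := x)) \<partial>(D \<Otimes>\<^sub>M samples D))"
    by (rule nn_integral_distr[OF m]) (simp add: f)
  also have "\<dots> = (\<integral>\<^sup>+z. (\<integral>\<^sup>+x. f (case (x, z) of (x, z) \<Rightarrow> z(i := x)) \<partial>D) \<partial>samples D)"
    by (rule DS.nn_integral_snd[symmetric]) (rule measurable_compose[OF m f])
  finally show ?thesis by simp
qed

lemma integral_samples_update:
  fixes f :: "_ \<Rightarrow> real"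
  assumes f: "integrable (samples D) f"
  shows "(\<integral>z. f z \<partial>samples D) = (\<integral>z. (\<integral>x. f (z(i := x)) \<partial>D) \<partial>samples D)"
proof -
  note m = measurable_samples_update[of i]
  have "(\<integral>z. f z \<partial>samples D) = (\<integral>z. f z \<partial>distr (D \<Otimes>\<^sub>M samples D) (samples D) (\<lambda>(x, z). z(i := x)))"
    by (simp add: distr_samples_update)
  also have "\<dots> = (\<integral>p. f (case p of (x, z) \<Rightarrow> z(i := x)) \<partial>(D \<Otimes>\<^sub>M samples D))"
    by (rule integral_distr[OF m]) (simp add: borel_measurable_integrable[OF f])
  also have "\<dots> = (\<integral>z. (\<integral>x. f (case (x, z) of (x, z) \<Rightarrow> z(i := x)) \<partial>D) \<partial>samples D)"
  proof -
    have "integrable (distr (D \<Otimes>\<^sub>M samples D) (samples D) (\<lambda>(x, z). z(i := x))) f"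
      using f by (simp add: distr_samples_update)
    then have "integrable (D \<Otimes>\<^sub>M samples D) (\<lambda>p. f (case p of (x, z) \<Rightarrow> z(i := x)))"
      by (rule integrable_distr[OF m])
    then show ?thesis
      using DS.integral_snd[of "\<lambda>x z. f (z(i := x))"] by (simp add: case_prod_unfold)
  qed
  finally show ?thesis by simp
qed

end

primrec batch_sgd ::
    "((nat \<Rightarrow> real) \<Rightarrow> real \<Rightarrow> nat \<Rightarrow> real) \<Rightarrow> (nat \<Rightarrow> (nat \<times> nat \<times> nat) set) \<Rightarrow> real
      \<Rightarrow> (nat \<times> nat \<times> nat \<Rightarrow> real) \<Rightarrow> nat \<Rightarrow> nat \<Rightarrow> real" where
  "batch_sgd g B \<eta> z 0 = (\<lambda>_. 0)"
| "batch_sgd g B \<eta> z (Suc t) =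
     (let x = batch_sgd g B \<eta> z t
      in (\<lambda>j. x j - \<eta> * (1 / real (card (B t)) * (\<Sum>i\<in>B t. g x (z i) j))))"

section \<open>Mean and variance of the gradient noise\<close>

locale nonconvex_oracle =
  fixes d :: nat and F :: "(nat \<Rightarrow> real) \<Rightarrow> real" and H \<Delta> \<sigma> :: real
    and D :: "real measure" and g :: "(nat \<Rightarrow> real) \<Rightarrow> real \<Rightarrow> nat \<Rightarrow> real"
  assumes F: "F \<in> nonconvex_class d H \<Delta>" and H: "H > 0"
    and query: "stochastic_gradient d F \<sigma> D g"
begin

lemma F_smooth: "smooth d H F"
  by (rule nonconvex_class_smooth[OF F])

lemma prob_D: "prob_space D"
  using query by (simp add: stochastic_gradient_def)

sublocale S: prob_space "samples D"
  by (rule prob_space_samples[OF prob_D])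

text \<open>\<open>X\<close> is a random query point, given as a function of the whole array of
  samples, and \<open>i\<close> is the sample that the query consumes. The moment lemmas require
  that \<open>X\<close> does not depend on coordinate \<open>i\<close>.\<close>

definition noise where
  "noise X i z j = g (X z) (z i) j - grad d F (X z) j"

definition mean_noise where
  "mean_noise B X z j = 1 / real (card B) * (\<Sum>i\<in>B. noise X i z j)"

lemma measurable_query:
  assumes X: "X \<in> measurable (samples D) (borel_Rd d)"
  shows "(\<lambda>z. g (X z) (z i)) \<in> measurable (samples D) (borel_Rd d)"
proof -
  have "(\<lambda>z. z i) \<in> measurable (samples D) D"
    unfolding samples_def by measurable
  then have "(\<lambda>z. (X z, z i)) \<in> measurable (samples D) (borel_Rd d \<Otimes>\<^sub>M D)"
    using X by (rule measurable_Pair[rotated])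
  from measurable_compose[OF this, of "\<lambda>(x, z). g x z"] show ?thesis
    using query by (simp add: stochastic_gradient_def)
qed

lemma measurable_noise:
  assumes X: "X \<in> measurable (samples D) (borel_Rd d)"
  shows "(\<lambda>z. noise X i z j) \<in> borel_measurable (samples D)"
  using measurable_query[OF X, of i] measurable_grad[OF F_smooth X, of j]
  unfolding noise_def measurable_borel_Rd_iff by (intro borel_measurable_diff) auto

text \<open>Resampling coordinate \<open>i\<close> leaves \<open>X z\<close> fixed, so the inner
  integral is the variance of the oracle at a fixed point. The nonnegative integral is used first
  because it yields the integrability that the later Bochner integrals need.\<close>

lemma noise_moment_nn:
  assumes X: "X \<in> measurable (samples D) (borel_Rd d)"
    and ind: "\<And>z x. X (z(i := x)) = X z"
  shows "(\<integral>\<^sup>+z. ennreal ((enorm d (noise X i z))\<^sup>2) \<partial>samples D) \<le> ennreal (\<sigma>\<^sup>2)"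
proof -
  have "(\<lambda>z. ennreal ((enorm d (noise X i z))\<^sup>2)) \<in> borel_measurable (samples D)"
    unfolding L2_set_squared using measurable_noise[OF X] by measurable
  then have "(\<integral>\<^sup>+z. ennreal ((enorm d (noise X i z))\<^sup>2) \<partial>samples D)
      = (\<integral>\<^sup>+z. (\<integral>\<^sup>+x. ennreal ((enorm d (\<lambda>j. g (X z) x j - grad d F (X z) j))\<^sup>2) \<partial>D) \<partial>samples D)"
    by (subst nn_integral_samples_update[OF prob_D, of _ i]) (auto simp: noise_def[abs_def] ind)
  also have "\<dots> \<le> (\<integral>\<^sup>+z. ennreal (\<sigma>\<^sup>2) \<partial>samples D)"
  proof (rule nn_integral_mono)
    fix z assume "z \<in> space (samples D)"
    then have "X z \<in> Rd d" using X by (simp add: measurable_borel_Rd_iff)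
    then show "(\<integral>\<^sup>+x. ennreal ((enorm d (\<lambda>j. g (X z) x j - grad d F (X z) j))\<^sup>2) \<partial>D) \<le> ennreal (\<sigma>\<^sup>2)"
      using query by (simp add: stochastic_gradient_def)
  qed
  also have "\<dots> = ennreal (\<sigma>\<^sup>2)"
    by (simp add: S.emeasure_space_1)
  finally show ?thesis .
qed

lemma square_integrable_noise:
  assumes X: "X \<in> measurable (samples D) (borel_Rd d)"
    and ind: "\<And>z x. X (z(i := x)) = X z" and j: "j < d"
  shows "square_integrable (samples D) (\<lambda>z. noise X i z j)"
proof (rule square_integrable_bound)
  show "(\<lambda>z. noise X i z j) \<in> borel_measurable (samples D)"
    by (rule measurable_noise[OF X])
  show "integrable (samples D) (\<lambda>z. (enorm d (noise X i z))\<^sup>2)"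
  proof (rule integrableI_bounded)
    show "(\<lambda>z. (enorm d (noise X i z))\<^sup>2) \<in> borel_measurable (samples D)"
      unfolding L2_set_squared using measurable_noise[OF X] by measurable
    show "(\<integral>\<^sup>+z. ennreal (norm ((enorm d (noise X i z))\<^sup>2)) \<partial>samples D) < \<infinity>"
      using noise_moment_nn[OF X ind] by (simp add: le_less_trans)
  qed
  show "(noise X i z j)\<^sup>2 \<le> (enorm d (noise X i z))\<^sup>2" for z
    unfolding L2_set_squared using j by (intro member_le_sum) auto
qed

lemma noise_moment:
  assumes X: "X \<in> measurable (samples D) (borel_Rd d)"
    and ind: "\<And>z x. X (z(i := x)) = X z"
  shows "(\<Sum>j<d. \<integral>z. (noise X i z j)\<^sup>2 \<partial>samples D) \<le> \<sigma>\<^sup>2"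
proof -
  have s: "square_integrable (samples D) (\<lambda>z. noise X i z j)" if "j \<in> {..<d}" for j
    using square_integrable_noise[OF X ind] that by simp
  have "ennreal (\<integral>z. (enorm d (noise X i z))\<^sup>2 \<partial>samples D) \<le> ennreal (\<sigma>\<^sup>2)"
    using noise_moment_nn[OF X ind] square_integrable_L2_set(1)[of "{..<d}" _ "noise X i", OF s]
    by (subst nn_integral_eq_integral[symmetric]) (auto simp: square_integrable_def)
  then show ?thesis
    using square_integrable_L2_set(2)[of "{..<d}" _ "noise X i", OF s] by simp
qed

text \<open>After resampling coordinate \<open>i\<close>, both \<open>V z\<close> and
  \<open>X z\<close> are constants of the inner integral, which vanishes because the oracle is
  unbiased. This plays the part of a conditional expectation given the past.\<close>

lemma noise_orthogonal:
  assumes X: "X \<in> measurable (samples D) (borel_Rd d)"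
    and ind: "\<And>z x. X (z(i := x)) = X z" and j: "j < d"
    and V: "square_integrable (samples D) V" and Vind: "\<And>z x. V (z(i := x)) = V z"
  shows "(\<integral>z. V z * noise X i z j \<partial>samples D) = 0"
proof -
  interpret D: prob_space D by (rule prob_D)
  have "(\<integral>z. V z * noise X i z j \<partial>samples D)
      = (\<integral>z. (\<integral>x. V z * (g (X z) x j - grad d F (X z) j) \<partial>D) \<partial>samples D)"
    unfolding integral_samples_update[OF prob_D
        square_integrable_mult[OF V square_integrable_noise[OF X ind j]], of i]
    by (simp add: noise_def ind Vind)
  also have "\<dots> = (\<integral>z. 0 \<partial>samples D)"
  proof (rule Bochner_Integration.integral_cong)
    fix z assume "z \<in> space (samples D)"
    then have "X z \<in> Rd d" using X by (simp add: measurable_borel_Rd_iff)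
    then have "integrable D (\<lambda>x. g (X z) x j)" "(\<integral>x. g (X z) x j \<partial>D) = grad d F (X z) j"
      using query j by (auto simp: stochastic_gradient_def)
    then show "(\<integral>x. V z * (g (X z) x j - grad d F (X z) j) \<partial>D) = 0"
      by (simp add: D.prob_space)
  qed simp
  finally show ?thesis by simp
qed

lemma square_integrable_mean_noise:
  assumes X: "X \<in> measurable (samples D) (borel_Rd d)"
    and ind: "\<And>i z x. i \<in> B \<Longrightarrow> X (z(i := x)) = X z" and j: "j < d"
  shows "square_integrable (samples D) (\<lambda>z. mean_noise B X z j)"
  unfolding mean_noise_def
  by (intro square_integrable_cmult square_integrable_sum square_integrable_noise X ind j)

lemma mean_noise_orthogonal:
  assumes X: "X \<in> measurable (samples D) (borel_Rd d)"
    and ind: "\<And>i z x. i \<in> B \<Longrightarrow> X (z(i := x)) = X z" and j: "j < d"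
    and V: "square_integrable (samples D) V"
    and Vind: "\<And>i z x. i \<in> B \<Longrightarrow> V (z(i := x)) = V z"
  shows "(\<integral>z. V z * mean_noise B X z j \<partial>samples D) = 0"
proof -
  have "(\<integral>z. V z * mean_noise B X z j \<partial>samples D)
      = (\<integral>z. 1 / real (card B) * (\<Sum>i\<in>B. V z * noise X i z j) \<partial>samples D)"
    by (simp add: mean_noise_def sum_distrib_left mult_ac)
  also have "\<dots> = 1 / real (card B) * (\<Sum>i\<in>B. \<integral>z. V z * noise X i z j \<partial>samples D)"
    by (subst integral_mult_right_zero, subst Bochner_Integration.integral_sum)
      (auto intro!: square_integrable_mult V square_integrable_noise X ind j)
  also have "\<dots> = 0"
    using noise_orthogonal[OF X ind j V Vind] by simp
  finally show ?thesis .
qed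

text \<open>Distinct samples have uncorrelated noise, so the expanded square keeps only its
  diagonal: \<open>card B\<close> terms, each contributing at most \<open>\<sigma>^2\<close>,
  divided by the square of \<open>card B\<close>.\<close>

lemma mean_noise_moment:
  assumes X: "X \<in> measurable (samples D) (borel_Rd d)" and B: "finite B"
    and ind: "\<And>i z x. i \<in> B \<Longrightarrow> X (z(i := x)) = X z"
  shows "(\<Sum>j<d. \<integral>z. (mean_noise B X z j)\<^sup>2 \<partial>samples D) \<le> \<sigma>\<^sup>2 / real (card B)"
proof -
  define b where "b = real (card B)"
  \<comment> \<open>For \<open>i ~= k\<close> the noise of sample \<open>k\<close> does not change
    when sample \<open>i\<close> is resampled, so it can take the place of \<open>V\<close> in
    \<open>noise_orthogonal\<close>.\<close>
  have cross: "(\<integral>z. noise X k z j * noise X i z j \<partial>samples D) =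
      (if i = k then \<integral>z. (noise X i z j)\<^sup>2 \<partial>samples D else 0)"
    if "i \<in> B" "k \<in> B" "j < d" for i k j
  proof (cases "i = k")
    case False
    have "(\<integral>z. noise X k z j * noise X i z j \<partial>samples D) = 0"
      using False that
      by (intro noise_orthogonal X square_integrable_noise ind) (auto simp: noise_def ind)
    then show ?thesis using False by simp
  qed (simp add: power2_eq_square)
  have "(\<integral>z. (mean_noise B X z j)\<^sup>2 \<partial>samples D)
      = 1 / b\<^sup>2 * (\<Sum>i\<in>B. \<integral>z. (noise X i z j)\<^sup>2 \<partial>samples D)" if j: "j < d" for j
  proof -
    have "(mean_noise B X z j)\<^sup>2 = 1 / b\<^sup>2 * (\<Sum>k\<in>B. \<Sum>i\<in>B. noise X k z j * noise X i z j)" for z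
      by (simp add: mean_noise_def b_def power_mult_distrib power_divide power2_eq_square sum_product)
    then have "(\<integral>z. (mean_noise B X z j)\<^sup>2 \<partial>samples D)
        = (\<integral>z. 1 / b\<^sup>2 * (\<Sum>k\<in>B. \<Sum>i\<in>B. noise X k z j * noise X i z j) \<partial>samples D)"
      by simp
    also have "\<dots> = 1 / b\<^sup>2 * (\<Sum>k\<in>B. \<Sum>i\<in>B. \<integral>z. noise X k z j * noise X i z j \<partial>samples D)"
      by (simp add: square_integrable_mult square_integrable_noise[OF X ind j] integrable_sum)
    also have "\<dots> = 1 / b\<^sup>2 * (\<Sum>k\<in>B. \<Sum>i\<in>B. if i = k then \<integral>z. (noise X i z j)\<^sup>2 \<partial>samples D else 0)"
      using cross j by simp
    finally show ?thesis using B by simp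
  qed
  then have "(\<Sum>j<d. \<integral>z. (mean_noise B X z j)\<^sup>2 \<partial>samples D)
      = (\<Sum>j<d. 1 / b\<^sup>2 * (\<Sum>i\<in>B. \<integral>z. (noise X i z j)\<^sup>2 \<partial>samples D))"
    by simp
  also have "\<dots> = 1 / b\<^sup>2 * (\<Sum>i\<in>B. \<Sum>j<d. \<integral>z. (noise X i z j)\<^sup>2 \<partial>samples D)"
    unfolding sum_distrib_left[symmetric] by (subst sum.swap) simp
  also have "\<dots> \<le> 1 / b\<^sup>2 * (\<Sum>i\<in>B. \<sigma>\<^sup>2)"
    by (intro mult_left_mono sum_mono noise_moment X ind) auto
  also have "\<dots> = \<sigma>\<^sup>2 / b" by (simp add: b_def power2_eq_square)
  finally show ?thesis by (simp add: b_def)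
qed

end

section \<open>Stochastic gradient descent with disjoint batches\<close>

text \<open>Disjoint batches make the samples of each step fresh. The condition
  \<open>\<eta> * H <= 1\<close> serves twice: in the descent inequality, and to keep one step from
  more than doubling the gradient norm, up to noise.\<close>

locale sgd_run = nonconvex_oracle +
  fixes B :: "nat \<Rightarrow> (nat \<times> nat \<times> nat) set" and b :: nat and \<eta> :: real
  assumes finite_B: "\<And>t. finite (B t)" and card_B: "\<And>t. card (B t) = b"
    and disjoint_B: "\<And>s t. s \<noteq> t \<Longrightarrow> B s \<inter> B t = {}" and b: "b > 0"
    and \<eta>: "\<eta> > 0" "\<eta> * H \<le> 1"
begin

section \<open>Measurability and square integrability along the run\<close>

definition iterate where "iterate t z = batch_sgd g B \<eta> z t"

definition G where "G t z j = grad d F (iterate t z) j"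

definition N where "N t z j = mean_noise (B t) (iterate t) z j"

text \<open>Iterate \<open>s\<close> is computed from the batches before \<open>s\<close> only, and
  these avoid \<open>B t\<close>. The case \<open>s = t\<close> supplies the independence hypotheses
  of the noise lemmas.\<close>

lemma iterate_update: "i \<in> B t \<Longrightarrow> s \<le> t \<Longrightarrow> iterate s (z(i := x)) = iterate s z"
proof (induction s)
  case (Suc s)
  then have "i \<notin> B s" using disjoint_B[of s t] by auto
  then have "(z(i := x)) k = z k" if "k \<in> B s" for k using that by auto
  with Suc show ?case by (simp add: iterate_def Let_def)
qed (simp add: iterate_def)

lemma iterate_Suc: "iterate (Suc t) z = (\<lambda>j. iterate t z j + - \<eta> * (G t z j + N t z j))"
proof
  fix j
  have "G t z j + N t z j = 1 / real b * (\<Sum>i\<in>B t. g (iterate t z) (z i) j)"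
    using b unfolding N_def G_def mean_noise_def noise_def
    by (simp add: sum_subtractf card_B field_simps)
  then show "iterate (Suc t) z j = iterate t z j + - \<eta> * (G t z j + N t z j)"
    by (simp add: iterate_def Let_def card_B)
qed

lemma measurable_iterate: "iterate t \<in> measurable (samples D) (borel_Rd d)"
proof (induction t)
  case 0
  then show ?case by (simp add: measurable_borel_Rd_iff iterate_def[abs_def])
next
  case (Suc t)
  have q: "(\<lambda>z. g (iterate t z) (z i) j) \<in> borel_measurable (samples D)" for i j
    using measurable_query[OF Suc, of i] by (simp add: measurable_borel_Rd_iff)
  have X: "(\<lambda>z. iterate t z j) \<in> borel_measurable (samples D)" for j
    using Suc by (simp add: measurable_borel_Rd_iff)
  have "iterate (Suc t) z \<in> Rd d" if "z \<in> space (samples D)" for z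
    using Suc measurable_query[OF Suc] that
    by (simp add: measurable_borel_Rd_iff iterate_def Let_def Rd_def)
  moreover have "(\<lambda>z. iterate (Suc t) z j) \<in> borel_measurable (samples D)" for j
    using q X unfolding iterate_def by (simp add: Let_def)
  ultimately show ?case by (simp add: measurable_borel_Rd_iff)
qed

lemma iterate_in_Rd: "z \<in> space (samples D) \<Longrightarrow> iterate t z \<in> Rd d"
  using measurable_iterate by (simp add: measurable_borel_Rd_iff)

lemma measurable_G: "(\<lambda>z. G t z j) \<in> borel_measurable (samples D)"
  unfolding G_def by (rule measurable_grad[OF F_smooth measurable_iterate])

lemma square_integrable_N: "j < d \<Longrightarrow> square_integrable (samples D) (\<lambda>z. N t z j)"
  unfolding N_def
  by (intro square_integrable_mean_noise measurable_iterate iterate_update) auto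

lemma square_integrable_norm_N: "square_integrable (samples D) (\<lambda>z. enorm d (N t z))"
  by (rule square_integrable_L2_set) (simp add: square_integrable_N)

lemma norm_N_moment: "(\<integral>z. (enorm d (N t z))\<^sup>2 \<partial>samples D) \<le> \<sigma>\<^sup>2 / b"
proof -
  have "(\<integral>z. (enorm d (N t z))\<^sup>2 \<partial>samples D) = (\<Sum>j<d. \<integral>z. (N t z j)\<^sup>2 \<partial>samples D)"
    by (rule square_integrable_L2_set) (simp add: square_integrable_N)
  also have "\<dots> \<le> \<sigma>\<^sup>2 / b"
    unfolding N_def card_B[of t, symmetric]
    by (intro mean_noise_moment measurable_iterate finite_B iterate_update) auto
  finally show ?thesis .
qed

text \<open>The Lipschitz gradient bounds the new norm by \<open>2 * |G| + \<eta> * H * |N|\<close>;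
  squaring with \<open>(a + b)^2 <= 2 * a^2 + 2 * b^2\<close> gives the constants 8 and 2.\<close>

lemma norm_G_Suc:
  assumes z: "z \<in> space (samples D)"
  shows "(enorm d (G (Suc t) z))\<^sup>2 \<le> 8 * (enorm d (G t z))\<^sup>2 + 2 * (\<eta> * H)\<^sup>2 * (enorm d (N t z))\<^sup>2"
proof -
  have "enorm d (G (Suc t) z) = enorm d (\<lambda>j. G t z j + (G (Suc t) z j - G t z j))"
    by simp
  also have "\<dots> \<le> enorm d (G t z) + enorm d (\<lambda>j. G (Suc t) z j - G t z j)"
    by (rule L2_set_triangle_ineq)
  also have "enorm d (\<lambda>j. G (Suc t) z j - G t z j)
      \<le> H * enorm d (\<lambda>j. iterate (Suc t) z j - iterate t z j)"
    using F_smooth iterate_in_Rd[OF z] by (simp add: smooth_def G_def)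
  also have "enorm d (\<lambda>j. iterate (Suc t) z j - iterate t z j) = \<eta> * enorm d (\<lambda>j. G t z j + N t z j)"
    using L2_set_cmult[of "- \<eta>" "\<lambda>j. G t z j + N t z j"] \<eta> by (simp add: iterate_Suc)
  also have "enorm d (\<lambda>j. G t z j + N t z j) \<le> enorm d (G t z) + enorm d (N t z)"
    by (rule L2_set_triangle_ineq)
  finally have "enorm d (G (Suc t) z)
      \<le> enorm d (G t z) + H * (\<eta> * (enorm d (G t z) + enorm d (N t z)))"
    using H \<eta> by (simp add: mult_left_mono)
  also have "\<dots> = enorm d (G t z) + (\<eta> * H) * enorm d (G t z) + (\<eta> * H) * enorm d (N t z)"
    by (simp add: algebra_simps)
  also have "\<dots> \<le> 2 * enorm d (G t z) + (\<eta> * H) * enorm d (N t z)"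
    using mult_right_mono[OF \<eta>(2), of "enorm d (G t z)"] by simp
  finally have "(enorm d (G (Suc t) z))\<^sup>2 \<le> (2 * enorm d (G t z) + (\<eta> * H) * enorm d (N t z))\<^sup>2"
    by (simp add: power_mono)
  also have "\<dots> \<le> 2 * (2 * enorm d (G t z))\<^sup>2 + 2 * ((\<eta> * H) * enorm d (N t z))\<^sup>2"
    using sum_squares_bound[of "2 * enorm d (G t z)" "(\<eta> * H) * enorm d (N t z)"]
    by (simp add: power2_sum)
  finally show ?thesis by (simp add: power_mult_distrib)
qed

text \<open>The gradient is not assumed bounded, so integrability is carried from step to step: the
  initial gradient is deterministic, and \<open>norm_G_Suc\<close> dominates each later one.\<close>

lemma square_integrable_norm_G: "square_integrable (samples D) (\<lambda>z. enorm d (G t z))"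
proof (induction t)
  case 0
  then show ?case by (simp add: square_integrable_def G_def[abs_def] iterate_def)
next
  case (Suc t)
  show ?case
  proof (rule square_integrable_bound)
    show "(\<lambda>z. enorm d (G (Suc t) z)) \<in> borel_measurable (samples D)"
      unfolding L2_set_def
      by (intro measurable_compose[OF _ borel_measurable_sqrt] borel_measurable_sum
          borel_measurable_power measurable_G)
    show "integrable (samples D)
        (\<lambda>z. 8 * (enorm d (G t z))\<^sup>2 + 2 * (\<eta> * H)\<^sup>2 * (enorm d (N t z))\<^sup>2)"
      using Suc square_integrable_norm_N[of t] by (simp add: square_integrable_def)
  qed (rule norm_G_Suc)
qed

lemma square_integrable_G: "j < d \<Longrightarrow> square_integrable (samples D) (\<lambda>z. G t z j)"
proof (rule square_integrable_bound)
  show "integrable (samples D) (\<lambda>z. (enorm d (G t z))\<^sup>2)"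
    using square_integrable_norm_G[of t] by (simp add: square_integrable_def)
  show "j < d \<Longrightarrow> (G t z j)\<^sup>2 \<le> (enorm d (G t z))\<^sup>2" for z
    unfolding L2_set_squared by (intro member_le_sum) auto
qed (rule measurable_G)

section \<open>Descent and bounds on the summed second moments\<close>

definition moment where "moment t = (\<integral>z. (enorm d (G t z))\<^sup>2 \<partial>samples D)"

lemma moment_nonneg: "moment t \<ge> 0"
  unfolding moment_def by (rule Bochner_Integration.integral_nonneg) simp

lemma moment_0: "moment 0 \<le> 2 * H * \<Delta>"
  using grad_zero_bound[OF F H] by (simp add: moment_def G_def[abs_def] iterate_def S.prob_space)

lemma moment_Suc: "moment (Suc t) \<le> 8 * moment t + 2 * (\<eta> * H)\<^sup>2 * (\<sigma>\<^sup>2 / b)"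
proof -
  have i: "integrable (samples D) (\<lambda>z. (enorm d (G t z))\<^sup>2)"
    "integrable (samples D) (\<lambda>z. (enorm d (N t z))\<^sup>2)" for t
    using square_integrable_norm_G square_integrable_norm_N by (auto simp: square_integrable_def)
  have "moment (Suc t)
      \<le> (\<integral>z. 8 * (enorm d (G t z))\<^sup>2 + 2 * (\<eta> * H)\<^sup>2 * (enorm d (N t z))\<^sup>2 \<partial>samples D)"
    unfolding moment_def using i by (intro integral_mono norm_G_Suc) auto
  also have "\<dots> = 8 * moment t + 2 * (\<eta> * H)\<^sup>2 * (\<integral>z. (enorm d (N t z))\<^sup>2 \<partial>samples D)"
    using i by (simp add: moment_def)
  also have "\<dots> \<le> 8 * moment t + 2 * (\<eta> * H)\<^sup>2 * (\<sigma>\<^sup>2 / b)"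
    by (intro add_left_mono mult_left_mono norm_N_moment) simp
  finally show ?thesis .
qed

text \<open>This is \<open>smooth_descent\<close> for the step \<open>- \<eta> * (G + N)\<close>.
  The inner product of \<open>G\<close> and \<open>N\<close> is kept exactly, since it has no sign
  pointwise but expectation zero.\<close>

lemma descent_step:
  assumes z: "z \<in> space (samples D)"
  shows "\<eta> / 2 * (enorm d (G t z))\<^sup>2 + (\<eta> - H * \<eta>\<^sup>2) * (\<Sum>j<d. G t z j * N t z j)
      - H * \<eta>\<^sup>2 / 2 * (enorm d (N t z))\<^sup>2 \<le> F (iterate t z) - F (iterate (Suc t) z)"
proof -
  define u where "u = (\<lambda>j. - \<eta> * (G t z j + N t z j))"
  define a c n where "a = (enorm d (G t z))\<^sup>2" and "c = (\<Sum>j<d. G t z j * N t z j)"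
    and "n = (enorm d (N t z))\<^sup>2"
  have Suc: "iterate (Suc t) z = (\<lambda>j. iterate t z j + u j)" by (simp add: u_def iterate_Suc)
  have "u = (\<lambda>j. iterate (Suc t) z j + (- 1) * iterate t z j)" by (auto simp: Suc)
  then have u: "u \<in> Rd d"
    using Rd_lincomb[OF iterate_in_Rd[OF z] iterate_in_Rd[OF z]] by metis
  have "F (iterate (Suc t) z)
      \<le> F (iterate t z) + (\<Sum>j<d. G t z j * u j) + H / 2 * (enorm d u)\<^sup>2"
    unfolding Suc G_def by (rule smooth_descent[OF F_smooth iterate_in_Rd[OF z] u])
  also have "(\<Sum>j<d. G t z j * u j) = - \<eta> * (a + c)"
    unfolding a_def c_def u_def L2_set_squared sum.distrib[symmetric] sum_distrib_left
    by (intro sum.cong) (auto simp: power2_eq_square algebra_simps)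
  also have "(enorm d u)\<^sup>2 = \<eta>\<^sup>2 * (a + 2 * c + n)"
    unfolding a_def c_def n_def u_def L2_set_squared sum.distrib[symmetric] sum_distrib_left
    by (intro sum.cong) (auto simp: power2_eq_square algebra_simps)
  finally have *: "F (iterate (Suc t) z)
      \<le> F (iterate t z) - \<eta> * (a + c) + H / 2 * (\<eta>\<^sup>2 * (a + 2 * c + n))" by simp
  \<comment> \<open>The quadratic term in \<open>G\<close> consumes at most half of the decrease
    \<open>\<eta> * a\<close>, which leaves the factor \<open>\<eta> / 2\<close>.\<close>
  have "(\<eta> * H) * (\<eta> * a) \<le> 1 * (\<eta> * a)"
    using \<eta> by (intro mult_right_mono) (auto simp: a_def)
  then have "H * \<eta>\<^sup>2 * a \<le> \<eta> * a" by (simp add: power2_eq_square mult_ac)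
  with * show ?thesis
    unfolding a_def[symmetric] c_def[symmetric] n_def[symmetric]
    by (simp add: algebra_simps)
qed

text \<open>In expectation the cross terms of \<open>descent_step\<close> vanish by orthogonality,
  while the decreases of \<open>F\<close> telescope to at most \<open>\<Delta>\<close>.\<close>

lemma sum_moment:
  "(\<Sum>t<T. moment t) \<le> 2 * \<Delta> / \<eta> + real T * (H * \<eta> * (\<sigma>\<^sup>2 / b))"
proof -
  define f where "f t z = \<eta> / 2 * (enorm d (G t z))\<^sup>2 + (\<eta> - H * \<eta>\<^sup>2) * (\<Sum>j<d. G t z j * N t z j)
      - H * \<eta>\<^sup>2 / 2 * (enorm d (N t z))\<^sup>2" for t z
  have GN: "integrable (samples D) (\<lambda>z. G t z j * N t z j)" if "j < d" for t j
    by (rule square_integrable_mult[OF square_integrable_G[OF that] square_integrable_N[OF that]])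
  have i: "integrable (samples D) (\<lambda>z. (enorm d (G t z))\<^sup>2)"
    "integrable (samples D) (\<lambda>z. (enorm d (N t z))\<^sup>2)"
    "integrable (samples D) (\<lambda>z. \<Sum>j<d. G t z j * N t z j)" for t
    using square_integrable_norm_G square_integrable_norm_N GN
    by (auto simp: square_integrable_def)
  have orth: "(\<integral>z. (\<Sum>j<d. G t z j * N t z j) \<partial>samples D) = 0" for t
  proof -
    have "(\<integral>z. G t z j * N t z j \<partial>samples D) = 0" if "j < d" for j
      unfolding N_def
      by (rule mean_noise_orthogonal[OF measurable_iterate _ that square_integrable_G[OF that]])
        (auto simp: iterate_update G_def)
    then show ?thesis using GN by simp
  qed
  have fi: "integrable (samples D) (f t)" for t
    unfolding f_def[abs_def] using i by simp
  have f: "(\<integral>z. f t z \<partial>samples D)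
      = \<eta> / 2 * moment t - H * \<eta>\<^sup>2 / 2 * (\<integral>z. (enorm d (N t z))\<^sup>2 \<partial>samples D)" for t
    unfolding f_def moment_def using i orth[of t] by simp
  have "\<eta> / 2 * (\<Sum>t<T. moment t) - real T * (H * \<eta>\<^sup>2 / 2 * (\<sigma>\<^sup>2 / b))
      = (\<Sum>t<T. \<eta> / 2 * moment t - H * \<eta>\<^sup>2 / 2 * (\<sigma>\<^sup>2 / b))"
    by (simp add: sum_subtractf sum_distrib_left)
  also have "\<dots> \<le> (\<Sum>t<T. \<integral>z. f t z \<partial>samples D)"
    unfolding f using H by (intro sum_mono diff_left_mono mult_left_mono norm_N_moment) auto
  also have "\<dots> = (\<integral>z. (\<Sum>t<T. f t z) \<partial>samples D)"
    using fi by simp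
  \<comment> \<open>The telescoping is done pointwise, under the integral: only \<open>f\<close> has
    to be integrable, not \<open>F\<close> at the iterates.\<close>
  also have "\<dots> \<le> (\<integral>z. \<Delta> \<partial>samples D)"
  proof (rule integral_mono)
    fix z assume z: "z \<in> space (samples D)"
    have "(\<Sum>t<T. f t z) \<le> (\<Sum>t<T. F (iterate t z) - F (iterate (Suc t) z))"
      unfolding f_def by (intro sum_mono descent_step z)
    also have "\<dots> = F (iterate 0 z) - F (iterate T z)"
      by (rule sum_lessThan_telescope')
    also have "\<dots> = F (\<lambda>_. 0) - F (iterate T z)" by (simp add: iterate_def)
    also have "\<dots> \<le> \<Delta>" by (rule nonconvex_class_gap[OF F iterate_in_Rd[OF z]])
    finally show "(\<Sum>t<T. f t z) \<le> \<Delta>" .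
  qed (use fi in auto)
  also have "\<dots> = \<Delta>" by (simp add: S.prob_space)
  finally show ?thesis using \<eta>(1) by (simp add: field_simps power2_eq_square)
qed

lemma sum_moment_Suc:
  "(\<Sum>t<T. moment (Suc t)) \<le> 16 * \<Delta> / \<eta> + 10 * real T * (H * \<eta> * (\<sigma>\<^sup>2 / b))"
proof -
  \<comment> \<open>Replacing \<open>(\<eta> * H)^2\<close> by \<open>\<eta> * H\<close> gives the
    noise of the shift the same form as in \<open>sum_moment\<close>; the constants become
    \<open>8 * 2 = 16\<close> and \<open>8 + 2 = 10\<close>.\<close>
  have "(\<eta> * H) * (\<eta> * H) \<le> 1 * (\<eta> * H)"
    using \<eta> H by (intro mult_right_mono) auto
  then have "(\<eta> * H)\<^sup>2 * (\<sigma>\<^sup>2 / b) \<le> (\<eta> * H) * (\<sigma>\<^sup>2 / b)"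
    by (intro mult_right_mono) (auto simp: power2_eq_square)
  then have "moment (Suc t) \<le> 8 * moment t + 2 * (H * \<eta> * (\<sigma>\<^sup>2 / b))" for t
    using moment_Suc[of t] unfolding mult.commute[of \<eta> H] mult.assoc[of 2] by linarith
  then have "(\<Sum>t<T. moment (Suc t)) \<le> (\<Sum>t<T. 8 * moment t + 2 * (H * \<eta> * (\<sigma>\<^sup>2 / b)))"
    by (rule sum_mono)
  also have "\<dots> = 8 * (\<Sum>t<T. moment t) + 2 * real T * (H * \<eta> * (\<sigma>\<^sup>2 / b))"
    by (simp add: sum.distrib sum_distrib_left)
  also have "\<dots> \<le> 8 * (2 * \<Delta> / \<eta> + real T * (H * \<eta> * (\<sigma>\<^sup>2 / b)))
      + 2 * real T * (H * \<eta> * (\<sigma>\<^sup>2 / b))"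
    by (intro add_right_mono mult_left_mono sum_moment) simp
  also have "\<dots> = 16 * \<Delta> / \<eta> + 10 * real T * (H * \<eta> * (\<sigma>\<^sup>2 / b))"
    by (simp add: algebra_simps)
  finally show ?thesis .
qed

text \<open>AM-GM with a free parameter \<open>a\<close> replaces Jensen's inequality.\<close>
lemma expected_norm_le:
  assumes a: "a > 0"
  shows "(\<integral>\<^sup>+z. ennreal (enorm d (G t z)) \<partial>samples D) \<le> ennreal (a / 2 + moment t / (2 * a))"
proof -
  have i: "integrable (samples D) (\<lambda>z. a / 2 + (enorm d (G t z))\<^sup>2 / (2 * a))"
    using square_integrable_norm_G[of t] by (simp add: square_integrable_def)
  have "enorm d (G t z) \<le> a / 2 + (enorm d (G t z))\<^sup>2 / (2 * a)" for z
    using sum_squares_bound[of a "enorm d (G t z)"] a by (simp add: field_simps power2_eq_square)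
  then have "(\<integral>\<^sup>+z. ennreal (enorm d (G t z)) \<partial>samples D)
      \<le> (\<integral>\<^sup>+z. ennreal (a / 2 + (enorm d (G t z))\<^sup>2 / (2 * a)) \<partial>samples D)"
    by (intro nn_integral_mono ennreal_leI)
  also have "\<dots> = ennreal (\<integral>z. a / 2 + (enorm d (G t z))\<^sup>2 / (2 * a) \<partial>samples D)"
    using a by (intro nn_integral_eq_integral i) auto
  also have "(\<integral>z. a / 2 + (enorm d (G t z))\<^sup>2 / (2 * a) \<partial>samples D) = a / 2 + moment t / (2 * a)"
    using square_integrable_norm_G[of t] by (simp add: moment_def square_integrable_def S.prob_space)
  finally show ?thesis .
qed

text \<open>The same parameter \<open>a = sqrt Q\<close> is used for all \<open>t\<close>, so only
  the sum of the moments matters; the two halves of the AM-GM bound then average to at most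
  \<open>sqrt Q / 2\<close> each.\<close>

lemma average_norm_le:
  assumes T: "T > 0" and Q: "Q > 0" and m: "(\<Sum>t<T. moment (Suc t)) \<le> real T * Q"
  shows "(\<Sum>t<T. \<integral>\<^sup>+z. ennreal (enorm d (G (Suc t) z)) \<partial>samples D) \<le> ennreal (real T * sqrt Q)"
proof -
  have "(\<Sum>t<T. \<integral>\<^sup>+z. ennreal (enorm d (G (Suc t) z)) \<partial>samples D)
      \<le> (\<Sum>t<T. ennreal (sqrt Q / 2 + moment (Suc t) / (2 * sqrt Q)))"
    using Q by (intro sum_mono expected_norm_le) simp
  also have "\<dots> = ennreal (\<Sum>t<T. sqrt Q / 2 + moment (Suc t) / (2 * sqrt Q))"
    using Q moment_nonneg by (intro sum_ennreal) simp
  also have "(\<Sum>t<T. sqrt Q / 2 + moment (Suc t) / (2 * sqrt Q))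
      = real T * (sqrt Q / 2) + (\<Sum>t<T. moment (Suc t)) / (2 * sqrt Q)"
    by (simp add: sum.distrib sum_divide_distrib)
  also have "\<dots> \<le> real T * (sqrt Q / 2) + (real T * Q) / (2 * sqrt Q)"
    using Q m by (intro add_left_mono divide_right_mono) auto
  also have "\<dots> = real T * sqrt Q"
    using Q real_sqrt_mult_self[of Q] by (simp add: field_simps)
  finally show ?thesis by (simp add: ennreal_leI)
qed

end

section \<open>The two methods\<close>

lemma root_4: "root 4 x = sqrt (sqrt x)"
  using real_root_mult_exp[of 2 2 x] by (simp add: sqrt_def)

text \<open>\<open>s\<close> stands for the noise level of one averaged gradient and
  \<open>T\<close> for the number of steps. The summand \<open>H\<close> enforces
  \<open>\<eta> * H <= 1\<close>.\<close>

definition stepsize :: "real \<Rightarrow> real \<Rightarrow> real \<Rightarrow> real \<Rightarrow> real" where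
  "stepsize H \<Delta> s T = 1 / (H + s * sqrt (H * T / \<Delta>))"

text \<open>With \<open>q = sqrt (H * T / \<Delta>)\<close>, the term
  \<open>\<Delta> / \<eta>\<close> equals \<open>H * \<Delta> + \<Delta> * s * q\<close> and the
  noise term is at most \<open>\<Delta> * s * q\<close>. The coefficients 16 and
  \<open>16 + 10\<close> are rounded up to 36, whose square root is the final constant 6.\<close>

lemma stepsize:
  assumes "H > 0" "\<Delta> > 0" "s \<ge> 0" "T > 0"
  shows "stepsize H \<Delta> s T > 0" "stepsize H \<Delta> s T * H \<le> 1"
    and "16 * \<Delta> / stepsize H \<Delta> s T + 10 * T * (H * stepsize H \<Delta> s T * s\<^sup>2)
      \<le> T * (36 * (H * \<Delta> / T + s * sqrt (H * \<Delta> / T)))"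
proof -
  define q where "q = sqrt (H * T / \<Delta>)"
  define \<eta> where "\<eta> = stepsize H \<Delta> s T"
  have q: "q > 0" "q\<^sup>2 = H * T / \<Delta>" using assms by (auto simp: q_def)
  have sq: "s * q \<ge> 0" using assms q by simp
  have e: "\<eta> = 1 / (H + s * q)" by (simp add: \<eta>_def stepsize_def q_def)
  show "stepsize H \<Delta> s T > 0" "stepsize H \<Delta> s T * H \<le> 1"
    using assms sq unfolding \<eta>_def[symmetric] e by (auto simp: add_pos_nonneg divide_le_eq_1)
  have r: "sqrt (H * \<Delta> / T) = \<Delta> * q / T"
  proof (rule real_sqrt_unique)
    show "(\<Delta> * q / T)\<^sup>2 = H * \<Delta> / T"
      using assms by (simp add: power_divide power_mult_distrib q(2)) (simp add: power2_eq_square)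
  qed (use assms q in auto)
  have "T * (H * \<eta> * s\<^sup>2) = \<Delta> * (s * q) * ((s * q) * \<eta>)"
  proof -
    have "T * H = \<Delta> * q\<^sup>2" using assms by (simp add: q(2))
    then have "(T * H) * (\<eta> * s\<^sup>2) = (\<Delta> * q\<^sup>2) * (\<eta> * s\<^sup>2)" by simp
    then show ?thesis by (simp add: power2_eq_square mult_ac)
  qed
  also have "\<dots> \<le> \<Delta> * (s * q) * 1"
    using assms sq unfolding e by (intro mult_left_mono) (auto simp: divide_le_eq_1 add_pos_nonneg)
  finally have "10 * T * (H * \<eta> * s\<^sup>2) \<le> 10 * (\<Delta> * (s * q))" by simp
  moreover have "16 * \<Delta> / \<eta> = 16 * (H * \<Delta>) + 16 * (\<Delta> * (s * q))"
    by (simp add: e algebra_simps)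
  moreover have "T * (36 * (H * \<Delta> / T + s * sqrt (H * \<Delta> / T))) = 36 * (H * \<Delta>) + 36 * (\<Delta> * (s * q))"
    unfolding r using assms by (simp add: field_simps)
  moreover have "H * \<Delta> \<ge> 0" "\<Delta> * (s * q) \<ge> 0" using assms sq by auto
  ultimately show "16 * \<Delta> / stepsize H \<Delta> s T + 10 * T * (H * stepsize H \<Delta> s T * s\<^sup>2)
      \<le> T * (36 * (H * \<Delta> / T + s * sqrt (H * \<Delta> / T)))"
    unfolding \<eta>_def[symmetric] by linarith
qed

lemma sqrt_rate:
  assumes "H > 0" "\<Delta> > 0" "\<sigma> \<ge> 0" "T > 0" "b > 0"
  shows "sqrt (36 * (H * \<Delta> / T + \<sigma> / sqrt b * sqrt (H * \<Delta> / T)))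
    \<le> 6 * (sqrt (H * \<Delta>) / sqrt T + sqrt \<sigma> * root 4 (H * \<Delta>) / root 4 (b * T))"
proof -
  have "sqrt (36 * (H * \<Delta> / T + \<sigma> / sqrt b * sqrt (H * \<Delta> / T)))
      = 6 * sqrt (H * \<Delta> / T + \<sigma> / sqrt b * sqrt (H * \<Delta> / T))"
    unfolding real_sqrt_mult[of 36] using real_sqrt_abs[of 6] by simp
  also have "\<dots> \<le> 6 * (sqrt (H * \<Delta> / T) + sqrt (\<sigma> / sqrt b * sqrt (H * \<Delta> / T)))"
    using assms by (intro mult_left_mono sqrt_add_le_add_sqrt) auto
  also have "\<dots> = 6 * (sqrt (H * \<Delta>) / sqrt T + sqrt \<sigma> * root 4 (H * \<Delta>) / root 4 (b * T))"
    by (simp add: root_4 real_sqrt_mult real_sqrt_divide)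
  finally show ?thesis .
qed

text \<open>The sum runs over the iterates \<open>1, ..., T\<close>, which the methods may return;
  division by \<open>T\<close> turns it into the error of a uniformly random one.\<close>

lemma (in nonconvex_oracle) batch_sgd_rate:
  fixes B :: "nat \<Rightarrow> (nat \<times> nat \<times> nat) set"
  assumes B: "\<And>t. finite (B t)" "\<And>t. card (B t) = b" "\<And>s t. s \<noteq> t \<Longrightarrow> B s \<inter> B t = {}" "b > 0"
    and pos: "\<Delta> > 0" "\<sigma> \<ge> 0" "T > 0"
    and step: "\<eta> = stepsize H \<Delta> (\<sigma> / sqrt b) T"
  shows "(\<Sum>t<T. \<integral>\<^sup>+z. ennreal (enorm d (grad d F (batch_sgd g B \<eta> z (Suc t)))) \<partial>samples D)
    \<le> ennreal (real T * (6 * (sqrt (H * \<Delta>) / sqrt T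
        + sqrt \<sigma> * root 4 (H * \<Delta>) / root 4 (real b * real T))))"
proof -
  define Q where "Q = 36 * (H * \<Delta> / T + \<sigma> / sqrt b * sqrt (H * \<Delta> / T))"
  have s: "\<sigma> / sqrt b \<ge> 0" "(\<sigma> / sqrt b)\<^sup>2 = \<sigma>\<^sup>2 / b"
    using pos by (auto simp: power_divide)
  note st = stepsize[OF H pos(1) s(1), of "real T", folded step, unfolded s(2)]
  interpret sgd_run d F H \<Delta> \<sigma> D g B b \<eta>
    using B st pos by unfold_locales auto
  have Q: "Q > 0" using H pos by (simp add: Q_def add_pos_nonneg)
  have "(\<Sum>t<T. moment (Suc t)) \<le> real T * Q"
    using order_trans[OF sum_moment_Suc st(3)] pos by (simp add: Q_def)
  then have "(\<Sum>t<T. \<integral>\<^sup>+z. ennreal (enorm d (G (Suc t) z)) \<partial>samples D) \<le> ennreal (real T * sqrt Q)"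
    using Q pos by (intro average_norm_le) auto
  also have "\<dots> \<le> ennreal (real T * (6 * (sqrt (H * \<Delta>) / sqrt T
        + sqrt \<sigma> * root 4 (H * \<Delta>) / root 4 (real b * real T))))"
    unfolding Q_def using H pos B by (intro ennreal_leI mult_left_mono sqrt_rate) auto
  finally show ?thesis unfolding G_def[abs_def] iterate_def .
qed

lemma (in nonconvex_oracle) first_iterate_rate:
  fixes B :: "nat \<Rightarrow> (nat \<times> nat \<times> nat) set"
  assumes B: "\<And>t. finite (B t)" "\<And>t. card (B t) = 1" "\<And>s t. s \<noteq> t \<Longrightarrow> B s \<inter> B t = {}"
    and pos: "\<Delta> > 0" "\<sigma> \<ge> 0"
    and step: "\<eta> = stepsize H \<Delta> \<sigma> 1"
  shows "(\<integral>\<^sup>+z. ennreal (enorm d (grad d F (batch_sgd g B \<eta> z 1))) \<partial>samples D)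
    \<le> ennreal (6 * sqrt (H * \<Delta>))"
proof -
  note st = stepsize[OF H pos, of 1, folded step]
  interpret sgd_run d F H \<Delta> \<sigma> D g B 1 \<eta>
    using B st pos by unfold_locales auto
  define q where "q = sqrt (H / \<Delta>)"
  have q: "q > 0" "q\<^sup>2 = H / \<Delta>" using H pos by (auto simp: q_def)
  \<comment> \<open>The noise of the single step is a fraction of \<open>H / q\<close>, which is
    \<open>sqrt (H * \<Delta>)\<close> however large \<open>\<sigma>\<close> is.\<close>
  have "\<eta> * H * \<sigma> = H / q * (\<sigma> * q / (H + \<sigma> * q))"
    using q pos(1) by (simp add: step stepsize_def q_def)
  also have "\<dots> \<le> H / q * 1"
    using H pos q by (intro mult_left_mono) (auto simp: divide_le_eq_1 add_pos_nonneg)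
  finally have "(\<eta> * H * \<sigma>)\<^sup>2 \<le> (H / q)\<^sup>2"
    using H pos st(1) by (intro power_mono) auto
  also have "(H / q)\<^sup>2 = H * \<Delta>"
    unfolding power_divide q(2) using H by (simp add: power2_eq_square)
  \<comment> \<open>The actual factor is \<open>8 * 2 + 2 = 18\<close>; it is relaxed to 36 so that
    the constant 6 is shared by all cases.\<close>
  finally have "moment 1 \<le> 36 * (H * \<Delta>)"
    using moment_Suc[of 0] moment_0 mult_pos_pos[OF H pos(1)] by (simp add: power_mult_distrib)
  then have "(\<Sum>t<1. \<integral>\<^sup>+z. ennreal (enorm d (G (Suc t) z)) \<partial>samples D)
      \<le> ennreal (real 1 * sqrt (36 * (H * \<Delta>)))"
    using H pos by (intro average_norm_le) auto
  moreover have "sqrt (36 * (H * \<Delta>)) = 6 * sqrt (H * \<Delta>)"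
    using real_sqrt_mult[of "6\<^sup>2"] by simp
  ultimately show ?thesis by (simp add: G_def[abs_def] iterate_def)
qed

section \<open>Both methods as instances of \<open>batch_sgd\<close>\<close>

lemma minibatch_iter_eq_batch_sgd:
  "minibatch_iter g M K (\<lambda>_. \<eta>) z r = batch_sgd g (\<lambda>r. {..<M} \<times> {..<K} \<times> {r}) \<eta> z r"
  by (induction r) (simp_all add: Let_def sum.cartesian_product')

text \<open>Steps are counted globally by \<open>t = r * K + k\<close>; for \<open>k < K\<close>,
  \<open>t mod K\<close> and \<open>t div K\<close> recover the query and the round. Allowing
  \<open>k = K\<close> covers the start of the next round.\<close>

lemma local_iter_eq_batch_sgd:
  assumes "k \<le> K"
  shows "local_iter g (\<lambda>_ _. \<eta>) z r (batch_sgd g (\<lambda>t. {(0, t mod K, t div K)}) \<eta> z (r * K)) k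
    = batch_sgd g (\<lambda>t. {(0, t mod K, t div K)}) \<eta> z (r * K + k)"
  using assms by (induction k) (simp_all add: Let_def)

lemma single_iter_eq_batch_sgd:
  assumes "k \<le> K"
  shows "single_iter g K (\<lambda>_ _. \<eta>) z k r = batch_sgd g (\<lambda>t. {(0, t mod K, t div K)}) \<eta> z (r * K + k)"
proof -
  have "round_start g K (\<lambda>_ _. \<eta>) z r = batch_sgd g (\<lambda>t. {(0, t mod K, t div K)}) \<eta> z (r * K)"
    by (induction r) (simp_all add: local_iter_eq_batch_sgd add.commute)
  then show ?thesis
    using assms by (simp add: single_iter_def local_iter_eq_batch_sgd)
qed

lemma minibatch_output_indicator:
  assumes "t \<in> {1..R}"
  shows "minibatch_output g M K R \<eta> (\<lambda>r. if r = t then 1 else 0) z = minibatch_iter g M K \<eta> z t"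
proof -
  have "(if r = t then 1 else 0) * a = (if r = t then a else 0)" for r and a :: real by simp
  then show ?thesis using assms by (simp add: minibatch_output_def)
qed

lemma single_output_indicator:
  assumes "k0 \<in> {1..K}" "r0 < R"
  shows "single_output g K R \<eta> (\<lambda>k r. if (k, r) = (k0, r0) then 1 else 0) z = single_iter g K \<eta> z k0 r0"
proof -
  have "(\<Sum>k=1..K. \<Sum>r<R. (if (k, r) = (k0, r0) then 1 else 0) * a k r) = a k0 r0" for a :: "nat \<Rightarrow> nat \<Rightarrow> real"
  proof -
    have "(if (k, r) = (k0, r0) then 1 else 0) * a k r
        = (if r = r0 then if k = k0 then a k0 r0 else 0 else 0)" for k r by auto
    then show ?thesis using assms by simp
  qed
  from this this[of "\<lambda>_ _. 1"] show ?thesis by (simp add: single_output_def)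
qed

text \<open>Since \<open>k\<close> starts at 1, \<open>r * K + k\<close> runs through
  \<open>1, ..., K * R\<close>: the last iterate of a round is counted there and not again as the
  start of the next.\<close>

lemma sum_round_major:
  fixes f :: "nat \<Rightarrow> 'a::comm_monoid_add"
  shows "(\<Sum>(k, r)\<in>{1..K} \<times> {..<R}. f (r * K + k)) = (\<Sum>t<K * R. f (Suc t))"
proof -
  have "(\<Sum>(k, r)\<in>{1..K} \<times> {..<R}. f (r * K + k)) = (\<Sum>r<R. \<Sum>k=1..K. f (r * K + k))"
    by (subst sum.cartesian_product[symmetric]) (rule sum.swap)
  also have "\<dots> = (\<Sum>r<R. \<Sum>t=r * K..<r * K + K. f (Suc t))"
    by (intro sum.cong refl
        sum.reindex_bij_witness[of _ "\<lambda>t. Suc t - r * K" "\<lambda>k. r * K + k - 1" for r]) auto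
  finally show ?thesis
    using sum.nat_group[of "\<lambda>t. f (Suc t)" K R] by (simp add: mult.commute)
qed

section \<open>Returning a random iterate, and the three terms of the minimum\<close>

lemma nn_integral_uniform_le:
  assumes S: "finite S" "S \<noteq> {}" and f: "(\<Sum>p\<in>S. f (h p)) \<le> ennreal (real (card S) * c)"
  shows "(\<integral>\<^sup>+w. f w \<partial>measure_pmf (map_pmf h (pmf_of_set S))) \<le> ennreal c"
proof -
  have n: "real (card S) > 0" using S by (simp add: card_gt_0_iff)
  have "(\<integral>\<^sup>+w. f w \<partial>measure_pmf (map_pmf h (pmf_of_set S))) = (\<Sum>p\<in>S. f (h p)) / card S"
    using S by (simp add: nn_integral_pmf_of_set)
  also have "\<dots> \<le> ennreal (real (card S) * c) / card S"
    by (intro divide_right_mono_ennreal f)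
  also have "\<dots> = ennreal c"
  proof (cases "c \<ge> 0")
    case True
    then show ?thesis using n by (simp add: ennreal_of_nat_eq_real_of_nat divide_ennreal)
  next
    \<comment> \<open>For negative \<open>c\<close> both sides are zero, because
      \<open>ennreal\<close> truncates.\<close>
    case False
    then show ?thesis using n by (simp add: ennreal_neg mult_nonneg_nonpos)
  qed
  finally show ?thesis .
qed

lemma minibatch_case:
  assumes "M \<ge> 1" "K \<ge> 1" "R \<ge> 1" "H > 0" "\<Delta> > 0" "\<sigma> \<ge> 0"
  shows "\<exists>\<eta> W. minibatch_params R \<eta> W \<and>
    (\<forall>d. \<forall>F\<in>nonconvex_class d H \<Delta>. \<forall>D g. stochastic_gradient d F \<sigma> D g \<longrightarrow>
      minibatch_error d F D g M K R \<eta> W \<le> ennreal (6 * (sqrt (H * \<Delta>) / sqrt (real R)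
        + sqrt \<sigma> * root 4 (H * \<Delta>) / root 4 (real M * real K * real R))))"
proof -
  \<comment> \<open>Averaging \<open>M * K\<close> independent samples reduces the noise level to
    \<open>\<sigma> / sqrt (M * K)\<close>.\<close>
  define e where "e = stepsize H \<Delta> (\<sigma> / sqrt (M * K)) R"
  define W where "W = map_pmf (\<lambda>t r. if r = t then 1 else 0 :: real) (pmf_of_set {1..R})"
  have "0 < e" using assms by (simp add: e_def stepsize)
  then have "minibatch_params R (\<lambda>_. e) W"
    using assms by (auto simp: minibatch_params_def W_def)
  moreover have "minibatch_error d F D g M K R (\<lambda>_. e) W
      \<le> ennreal (6 * (sqrt (H * \<Delta>) / sqrt (real R)
        + sqrt \<sigma> * root 4 (H * \<Delta>) / root 4 (real M * real K * real R)))"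
    if "F \<in> nonconvex_class d H \<Delta>" "stochastic_gradient d F \<sigma> D g" for d F D g
  proof -
    interpret nonconvex_oracle d F H \<Delta> \<sigma> D g
      using that assms by unfold_locales
    define f where "f t = (\<integral>\<^sup>+z. ennreal (enorm d (grad d F
      (batch_sgd g (\<lambda>r. {..<M} \<times> {..<K} \<times> {r}) e z t))) \<partial>samples D)" for t
    have "(\<Sum>t<R. f (Suc t)) \<le> ennreal (real R * (6 * (sqrt (H * \<Delta>) / sqrt (real R)
        + sqrt \<sigma> * root 4 (H * \<Delta>) / root 4 (real (M * K) * real R))))"
      unfolding f_def using assms by (intro batch_sgd_rate) (auto simp: e_def)
    also have "(\<Sum>t<R. f (Suc t)) = (\<Sum>t\<in>{1..R}. f t)"
      by (simp add: sum.atLeast1_atMost_eq)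
    finally show ?thesis
      unfolding minibatch_error_def W_def using assms
      by (intro nn_integral_uniform_le)
        (simp_all add: minibatch_output_indicator[simplified] minibatch_iter_eq_batch_sgd f_def mult.assoc)
  qed
  ultimately show ?thesis by blast
qed

lemma single_params_uniform:
  assumes "e > 0" "S \<subseteq> {1..K} \<times> {..<R}" "S \<noteq> {}"
  shows "single_params K R (\<lambda>_ _. e)
    (map_pmf (\<lambda>p k r. if (k, r) = p then 1 else 0 :: real) (pmf_of_set S))"
proof -
  have "finite S" using assms(2) by (rule finite_subset) simp
  moreover have "(\<Sum>k=1..K. \<Sum>r<R. if (k, r) = p then 1 else 0 :: real) = 1" if "p \<in> S" for p
    using subsetD[OF assms(2) that]
    by (subst sum.cartesian_product) (simp add: case_prod_unfold)
  ultimately show ?thesis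
    using assms by (auto simp: single_params_def)
qed

text \<open>The set \<open>S\<close> is arbitrary so that one argument serves both the draw from all
  iterates and the deterministic choice of the first one.\<close>

lemma single_error_uniform:
  assumes S: "S \<subseteq> {1..K} \<times> {..<R}" "S \<noteq> {}"
    and le: "(\<Sum>(k, r)\<in>S. \<integral>\<^sup>+z. ennreal (enorm d (grad d F
      (batch_sgd g (\<lambda>t. {(0, t mod K, t div K)}) e z (r * K + k)))) \<partial>samples D)
        \<le> ennreal (real (card S) * c)"
  shows "single_error d F D g K R (\<lambda>_ _. e)
    (map_pmf (\<lambda>p k r. if (k, r) = p then 1 else 0 :: real) (pmf_of_set S)) \<le> ennreal c"
  unfolding single_error_def
proof (rule nn_integral_uniform_le)
  show "finite S" using S(1) by (rule finite_subset) simp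
  have "single_output g K R (\<lambda>_ _. e) (\<lambda>k r. if (k, r) = p then 1 else 0) z
      = batch_sgd g (\<lambda>t. {(0, t mod K, t div K)}) e z (snd p * K + fst p)" if "p \<in> S" for p z
    using that S single_output_indicator[of "fst p" K "snd p" R g "\<lambda>_ _. e" z]
      single_iter_eq_batch_sgd[of "fst p" K g e z "snd p"] by auto
  then show "(\<Sum>p\<in>S. \<integral>\<^sup>+z. ennreal (enorm d (grad d F (single_output g K R (\<lambda>_ _. e)
      (\<lambda>k r. if (k, r) = p then 1 else 0) z))) \<partial>samples D) \<le> ennreal (real (card S) * c)"
    using le by (simp add: case_prod_unfold)
qed (rule S)

lemma disjoint_queries: "s \<noteq> t \<Longrightarrow> {(0::nat, s mod K, s div K)} \<inter> {(0, t mod K, t div K)} = {}" for s :: nat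
  by simp (metis mod_div_mult_eq)

lemma single_case:
  assumes "K \<ge> 1" "R \<ge> 1" "H > 0" "\<Delta> > 0" "\<sigma> \<ge> 0"
  shows "\<exists>\<eta> W. single_params K R \<eta> W \<and>
    (\<forall>d. \<forall>F\<in>nonconvex_class d H \<Delta>. \<forall>D g. stochastic_gradient d F \<sigma> D g \<longrightarrow>
      single_error d F D g K R \<eta> W \<le> ennreal (6 * (sqrt (H * \<Delta>) / sqrt (real K * real R)
        + sqrt \<sigma> * root 4 (H * \<Delta>) / root 4 (real K * real R))))"
proof -
  define e where "e = stepsize H \<Delta> (\<sigma> / sqrt (real 1)) (real (K * R))"
  define S where "S = {1..K} \<times> {..<R}"
  have S: "S \<subseteq> {1..K} \<times> {..<R}" "S \<noteq> {}" using assms by (auto simp: S_def lessThan_empty_iff)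
  have "0 < e" using assms by (auto simp: e_def intro!: stepsize)
  then have "single_params K R (\<lambda>_ _. e)
      (map_pmf (\<lambda>p k r. if (k, r) = p then 1 else 0 :: real) (pmf_of_set S))"
    using S by (rule single_params_uniform)
  moreover have "single_error d F D g K R (\<lambda>_ _. e)
      (map_pmf (\<lambda>p k r. if (k, r) = p then 1 else 0 :: real) (pmf_of_set S))
      \<le> ennreal (6 * (sqrt (H * \<Delta>) / sqrt (real K * real R)
        + sqrt \<sigma> * root 4 (H * \<Delta>) / root 4 (real K * real R)))"
    if "F \<in> nonconvex_class d H \<Delta>" "stochastic_gradient d F \<sigma> D g" for d F D g
  proof (rule single_error_uniform[OF S])
    interpret nonconvex_oracle d F H \<Delta> \<sigma> D g
      using that assms by unfold_locales
    define f where "f t = (\<integral>\<^sup>+z. ennreal (enorm d (grad d F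
      (batch_sgd g (\<lambda>t. {(0, t mod K, t div K)}) e z t))) \<partial>samples D)" for t
    have "(\<Sum>t<K * R. f (Suc t)) \<le> ennreal (real (K * R) * (6 * (sqrt (H * \<Delta>) / sqrt (real (K * R))
        + sqrt \<sigma> * root 4 (H * \<Delta>) / root 4 (real 1 * real (K * R)))))"
      unfolding f_def using assms disjoint_queries by (intro batch_sgd_rate) (auto simp: e_def)
    then have "(\<Sum>(k, r)\<in>S. f (r * K + k)) \<le> ennreal (real (card S) * (6 * (sqrt (H * \<Delta>)
        / sqrt (real K * real R) + sqrt \<sigma> * root 4 (H * \<Delta>) / root 4 (real K * real R))))"
      unfolding S_def sum_round_major by simp
    then show "(\<Sum>(k, r)\<in>S. \<integral>\<^sup>+z. ennreal (enorm d (grad d F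
      (batch_sgd g (\<lambda>t. {(0, t mod K, t div K)}) e z (r * K + k)))) \<partial>samples D)
        \<le> ennreal (real (card S) * (6 * (sqrt (H * \<Delta>)
        / sqrt (real K * real R) + sqrt \<sigma> * root 4 (H * \<Delta>) / root 4 (real K * real R))))"
      unfolding f_def .
  qed
  ultimately show ?thesis by blast
qed

lemma first_iterate_case:
  assumes "K \<ge> 1" "R \<ge> 1" "H > 0" "\<Delta> > 0" "\<sigma> \<ge> 0"
  shows "\<exists>\<eta> W. single_params K R \<eta> W \<and>
    (\<forall>d. \<forall>F\<in>nonconvex_class d H \<Delta>. \<forall>D g. stochastic_gradient d F \<sigma> D g \<longrightarrow>
      single_error d F D g K R \<eta> W \<le> ennreal (6 * sqrt (H * \<Delta>)))"
proof -
  define e where "e = stepsize H \<Delta> \<sigma> 1"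
  \<comment> \<open>All weight goes to \<open>k = 1\<close> in round 0, the iterate after one step;
    the later steps are taken but not returned.\<close>
  define S where "S = {(1::nat, 0::nat)}"
  have S: "S \<subseteq> {1..K} \<times> {..<R}" "S \<noteq> {}" using assms by (auto simp: S_def lessThan_empty_iff)
  have "0 < e" using assms by (auto simp: e_def intro!: stepsize)
  then have "single_params K R (\<lambda>_ _. e)
      (map_pmf (\<lambda>p k r. if (k, r) = p then 1 else 0 :: real) (pmf_of_set S))"
    using S by (rule single_params_uniform)
  moreover have "single_error d F D g K R (\<lambda>_ _. e)
      (map_pmf (\<lambda>p k r. if (k, r) = p then 1 else 0 :: real) (pmf_of_set S))
      \<le> ennreal (6 * sqrt (H * \<Delta>))"
    if "F \<in> nonconvex_class d H \<Delta>" "stochastic_gradient d F \<sigma> D g" for d F D g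
  proof (rule single_error_uniform[OF S])
    interpret nonconvex_oracle d F H \<Delta> \<sigma> D g
      using that assms by unfold_locales
    have "(\<integral>\<^sup>+z. ennreal (enorm d (grad d F
      (batch_sgd g (\<lambda>t. {(0, t mod K, t div K)}) e z 1))) \<partial>samples D) \<le> ennreal (6 * sqrt (H * \<Delta>))"
      using assms disjoint_queries by (intro first_iterate_rate) (auto simp: e_def)
    then show "(\<Sum>(k, r)\<in>S. \<integral>\<^sup>+z. ennreal (enorm d (grad d F
      (batch_sgd g (\<lambda>t. {(0, t mod K, t div K)}) e z (r * K + k)))) \<partial>samples D)
        \<le> ennreal (real (card S) * (6 * sqrt (H * \<Delta>)))"
      by (simp add: S_def del: batch_sgd.simps)
  qed
  ultimately show ?thesis by blast
qed

theorem theorem16: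
  "\<exists>c>0::real. \<forall>(M::nat) (K::nat) (R::nat) (H::real) (\<Delta>::real) (\<sigma>::real).
     M \<ge> 1 \<longrightarrow> K \<ge> 1 \<longrightarrow> R \<ge> 1 \<longrightarrow> H > 0 \<longrightarrow> \<Delta> > 0 \<longrightarrow> \<sigma> \<ge> 0 \<longrightarrow>
     (\<exists>\<eta> W. minibatch_params R \<eta> W \<and>
        (\<forall>d. \<forall>F\<in>nonconvex_class d H \<Delta>. \<forall>D g. stochastic_gradient d F \<sigma> D g \<longrightarrow>
           minibatch_error d F D g M K R \<eta> W \<le> ennreal (c * rate M K R H \<Delta> \<sigma>))) \<or>
     (\<exists>\<eta> W. single_params K R \<eta> W \<and>
        (\<forall>d. \<forall>F\<in>nonconvex_class d H \<Delta>. \<forall>D g. stochastic_gradient d F \<sigma> D g \<longrightarrow>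
           single_error d F D g K R \<eta> W \<le> ennreal (c * rate M K R H \<Delta> \<sigma>)))"
proof (intro exI[of _ 6] conjI allI impI)
  fix M K R :: nat and H \<Delta> \<sigma> :: real
  assume a: "M \<ge> 1" "K \<ge> 1" "R \<ge> 1" "H > 0" "\<Delta> > 0" "\<sigma> \<ge> 0"
  have "rate M K R H \<Delta> \<sigma> \<in>
     {sqrt (H * \<Delta>) / sqrt (real K * real R)
        + sqrt \<sigma> * root 4 (H * \<Delta>) / root 4 (real K * real R),
      sqrt (H * \<Delta>) / sqrt (real R)
        + sqrt \<sigma> * root 4 (H * \<Delta>) / root 4 (real M * real K * real R),
      sqrt (H * \<Delta>)}"
    unfolding rate_def by (rule Min_in) auto
  \<comment> \<open>The term attaining the minimum selects the method. It depends on
    \<open>M\<close>, \<open>K\<close>, \<open>R\<close>, \<open>H\<close>, \<open>\<Delta>\<close>,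
    \<open>\<sigma>\<close> alone, so the choice precedes \<open>d\<close>, \<open>F\<close> and the
    oracle.\<close>
  then consider
    "rate M K R H \<Delta> \<sigma> = sqrt (H * \<Delta>) / sqrt (real K * real R)
        + sqrt \<sigma> * root 4 (H * \<Delta>) / root 4 (real K * real R)"
  | "rate M K R H \<Delta> \<sigma> = sqrt (H * \<Delta>) / sqrt (real R)
        + sqrt \<sigma> * root 4 (H * \<Delta>) / root 4 (real M * real K * real R)"
  | "rate M K R H \<Delta> \<sigma> = sqrt (H * \<Delta>)"
    by blast
  then show "(\<exists>\<eta> W. minibatch_params R \<eta> W \<and>
        (\<forall>d. \<forall>F\<in>nonconvex_class d H \<Delta>. \<forall>D g. stochastic_gradient d F \<sigma> D g \<longrightarrow>
           minibatch_error d F D g M K R \<eta> W \<le> ennreal (6 * rate M K R H \<Delta> \<sigma>))) \<or>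
     (\<exists>\<eta> W. single_params K R \<eta> W \<and>
        (\<forall>d. \<forall>F\<in>nonconvex_class d H \<Delta>. \<forall>D g. stochastic_gradient d F \<sigma> D g \<longrightarrow>
           single_error d F D g K R \<eta> W \<le> ennreal (6 * rate M K R H \<Delta> \<sigma>)))"
  proof cases
    case 1
    show ?thesis unfolding 1 by (rule disjI2, rule single_case[OF a(2-6)])
  next
    case 2
    show ?thesis unfolding 2 by (rule disjI1, rule minibatch_case[OF a])
  next
    case 3
    show ?thesis unfolding 3 by (rule disjI2, rule first_iterate_case[OF a(2-6)])
  qed
qed simp

end
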